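(* Let $\mathbb{K}$ be an algebraically closed field of characteristic $2$, $n>2$, and let $\mathfrak{g}=\mathfrak{o}^{(2)}_\Pi(2n)/\mathfrak{c}$, where $\mathfrak{c}$ is the center (trivial if $n$ is odd). Assume that $\mathrm{Der}\,\mathfrak{g}\cong\tilde{\mathfrak{o}}_{\Pi}(2n)/\mathfrak{c}'$, i.e. every derivation of $\mathfrak{g}$ is induced by $\mathrm{ad}_M$ for some $M\in\tilde{\mathfrak{o}}_{\Pi}(2n)$ ($\mathfrak{c}'$ the scalar matrices). Then for every $\mathbb{Z}/2$-grading of $\mathfrak{g}$, the associated Lie superalgebra $S(\mathfrak{g}^{<1>})$ is isomorphic to one of $\mathfrak{oo}^{(2)}_{\Pi\Pi}(2k|2n-2k)/\mathfrak{c}$ with $0\leq k\leq\lfloor n/2\rfloor$, or $\mathfrak{pe}^{(2)}(n)/\mathfrak{c}$, where $/\mathfrak{c}$ denotes quotient by the center (which is trivial when $n$ is odd).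
   Context: A Lie superalgebra in characteristic $2$: superspace $\mathfrak{h}=\mathfrak{h}_{\bar0}\oplus\mathfrak{h}_{\bar1}$, $\mathfrak{h}_{\bar0}$ a Lie algebra, $\mathfrak{h}_{\bar1}$ an $\mathfrak{h}_{\bar0}$-module, squaring $x\mapsto x^2\in\mathfrak{h}_{\bar0}$ on $\mathfrak{h}_{\bar1}$ with $(ax)^2=a^2x^2$, $[x,y]:=(x+y)^2-x^2-y^2$ bilinear, $[x^2,y]=[x,[x,y]]$, $[x^2,x]=0$. For a Lie (super)algebra $\mathfrak{h}$, $\mathfrak{h}^{(1)}$ is the span of all brackets and squares of odd elements, $\mathfrak{h}^{(2)}=(\mathfrak{h}^{(1)})^{(1)}$. A $\mathbb{Z}/2$-grading of a Lie algebra $\mathfrak{g}$: $\mathfrak{g}=\mathfrak{g}_{\bar0}\oplus\mathfrak{g}_{\bar1}$ with $[\mathfrak{g}_i,\mathfrak{g}_j]\subset\mathfrak{g}_{i+j}$. For centerless $\mathfrak{g}$ identified with $\mathrm{ad}\,\mathfrak{g}\subset\mathrm{Der}\,\mathfrak{g}$, $\mathfrak{g}^{<1>}$ is the smallest Lie subalgebra of $\mathrm{Der}\,\mathfrak{g}$ containing $\mathrm{ad}\,\mathfrak{g}$ and all $(\mathrm{ad}_x)^2$, $x\in\mathfrak{g}_{\bar1}$, graded by: even derivations preserve each $\mathfrak{g}_i$, odd ones map $\mathfrak{g}_i$ into $\mathfrak{g}_{i+1}$. $S(\mathfrak{g}^{<1>})$ is the Lie superalgebra on $\mathfrak{g}^{<1>}$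 with the same brackets involving even elements and squaring $x^2:=(\mathrm{ad}_x)^2$ for odd $x$. $\Pi_{2k}=\begin{pmatrix}0&I_k\\ I_k&0\end{pmatrix}$. $\mathfrak{o}_\Pi(2n)=\{X\in\mathfrak{gl}(2n):X^T\Pi_{2n}+\Pi_{2n}X=0\}$; $\tilde{\mathfrak{o}}_\Pi(2n)=\{M\in\mathfrak{gl}(2n):\exists c_M\in\mathbb{K},\ B(Mx,y)+B(x,My)=c_MB(x,y)\ \forall x,y\}$, $B$ the form with Gram matrix $\Pi_{2n}$. $\mathfrak{oo}_{\Pi\Pi}(a|b)$: supermatrices $X\in\mathfrak{gl}(a|b)$ (block-diagonal even, block-off-diagonal odd, commutator bracket, squaring of odd matrices the matrix square) with $X^TG+GX=0$, $G=\mathrm{diag}(\Pi_a,\Pi_b)$; conventions $\mathfrak{oo}_{\Pi\Pi}(0|2n)=\mathfrak{o}_\Pi(2n)$. $\mathfrak{pe}(n)$: supermatrices $X\in\mathfrak{gl}(n|n)$ with $X^T\Pi_{2n}+\Pi_{2n}X=0$, i.e. preserving the odd nondegenerate form with Gram matrix $\Pi_{2n}$ pairing the even and odd subspaces. *)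

theory Defs
  imports "HOL-Computational_Algebra.Polynomial" "Jordan_Normal_Form.Matrix"
begin

text \<open>A Lie superalgebra over the field 'k with elements of type 'v:
  underlying set, even part, odd part, vector space operations, bracket,
  and squaring (only meaningful on odd elements).\<close>

record ('k, 'v) lsa =
  lcar  :: "'v set"
  lev   :: "'v set"
  lodd  :: "'v set"
  lzero :: 'v
  ladd  :: "'v \<Rightarrow> 'v \<Rightarrow> 'v"
  lsmul :: "'k \<Rightarrow> 'v \<Rightarrow> 'v"
  lbr   :: "'v \<Rightarrow> 'v \<Rightarrow> 'v"
  lsq   :: "'v \<Rightarrow> 'v"

inductive_set lspan :: "('k, 'v) lsa \<Rightarrow> 'v set \<Rightarrow> 'v set" for h S where
  lspan_zero: "lzero h \<in> lspan h S"
| lspan_base: "x \<in> S \<Longrightarrow> x \<in> lspan h S"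
| lspan_add: "u \<in> lspan h S \<Longrightarrow> v \<in> lspan h S \<Longrightarrow> ladd h u v \<in> lspan h S"
| lspan_smul: "u \<in> lspan h S \<Longrightarrow> lsmul h c u \<in> lspan h S"

definition derived :: "('k, 'v) lsa \<Rightarrow> ('k, 'v) lsa" where
  "derived h = (let D = lspan h ({lbr h x y | x y. x \<in> lcar h \<and> y \<in> lcar h}
                                \<union> {lsq h x | x. x \<in> lodd h})
                in h\<lparr>lcar := D, lev := D \<inter> lev h, lodd := D \<inter> lodd h\<rparr>)"

definition center :: "('k, 'v) lsa \<Rightarrow> 'v set" where
  "center h = {z \<in> lcar h. \<forall>x \<in> lcar h. lbr h z x = lzero h}"

definition coset :: "('k, 'v) lsa \<Rightarrow> 'v set \<Rightarrow> 'v \<Rightarrow> 'v set" where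
  "coset h I x = {ladd h x i | i. i \<in> I}"

definition quot :: "('k, 'v) lsa \<Rightarrow> 'v set \<Rightarrow> ('k, 'v set) lsa" where
  "quot h I = \<lparr>
     lcar = coset h I ` lcar h,
     lev = coset h I ` lev h,
     lodd = coset h I ` lodd h,
     lzero = coset h I (lzero h),
     ladd = (\<lambda>C D. coset h I (ladd h (SOME x. x \<in> C) (SOME y. y \<in> D))),
     lsmul = (\<lambda>c C. coset h I (lsmul h c (SOME x. x \<in> C))),
     lbr = (\<lambda>C D. coset h I (lbr h (SOME x. x \<in> C) (SOME y. y \<in> D))),
     lsq = (\<lambda>C. coset h I (lsq h (SOME x. x \<in> C \<inter> lodd h))) \<rparr>"

definition lsa_iso :: "('k, 'v) lsa \<Rightarrow> ('k, 'w) lsa \<Rightarrow> bool" where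
  "lsa_iso h h' \<longleftrightarrow> (\<exists>\<phi>. bij_betw \<phi> (lcar h) (lcar h')
      \<and> \<phi> ` lev h = lev h' \<and> \<phi> ` lodd h = lodd h'
      \<and> (\<forall>x \<in> lcar h. \<forall>y \<in> lcar h. \<phi> (ladd h x y) = ladd h' (\<phi> x) (\<phi> y))
      \<and> (\<forall>c. \<forall>x \<in> lcar h. \<phi> (lsmul h c x) = lsmul h' c (\<phi> x))
      \<and> (\<forall>x \<in> lcar h. \<forall>y \<in> lcar h. \<phi> (lbr h x y) = lbr h' (\<phi> x) (\<phi> y))
      \<and> (\<forall>x \<in> lodd h. \<phi> (lsq h x) = lsq h' (\<phi> x)))"

text \<open>Entries of Pi_m = [[0, I_{m/2}], [I_{m/2}, 0]] (m even).\<close>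
definition Pi_entry :: "nat \<Rightarrow> nat \<Rightarrow> nat \<Rightarrow> 'a::field" where
  "Pi_entry m i j = (if (i < m div 2 \<and> j = i + m div 2) \<or> (m div 2 \<le> i \<and> i + m div 2 = j + m) then 1 else 0)"

definition Pi_mat :: "nat \<Rightarrow> 'a::field mat" where
  "Pi_mat m = mat m m (\<lambda>(i, j). Pi_entry m i j)"

definition gram :: "nat \<Rightarrow> nat \<Rightarrow> 'a::field mat" where
  "gram a b = mat (a + b) (a + b) (\<lambda>(i, j).
      if i < a \<and> j < a then Pi_entry a i j
      else if a \<le> i \<and> a \<le> j then Pi_entry b (i - a) (j - a) else 0)"

text \<open>Matrix Lie superalgebra of (a|b) supermatrices satisfying P: indices < a are even,
  indices >= a are odd; even matrices are block diagonal, odd ones block off-diagonal;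
  commutator bracket, squaring = matrix square.\<close>
definition mat_lsa :: "nat \<Rightarrow> nat \<Rightarrow> ('a::field mat \<Rightarrow> bool) \<Rightarrow> ('a, 'a mat) lsa" where
  "mat_lsa a b P = (let N = a + b; C = {X \<in> carrier_mat N N. P X} in \<lparr>
     lcar = C,
     lev = {X \<in> C. \<forall>i < N. \<forall>j < N. (i < a) \<noteq> (j < a) \<longrightarrow> X $$ (i, j) = 0},
     lodd = {X \<in> C. \<forall>i < N. \<forall>j < N. (i < a) = (j < a) \<longrightarrow> X $$ (i, j) = 0},
     lzero = 0\<^sub>m N N,
     ladd = (+),
     lsmul = (\<lambda>c X. c \<cdot>\<^sub>m X),
     lbr = (\<lambda>X Y. X * Y - Y * X),
     lsq = (\<lambda>X. X * X) \<rparr>)"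

text \<open>oo_{Pi Pi}(a|b); in particular oo_{Pi Pi}(0|2n) = o_Pi(2n) (purely even).\<close>
definition oo_PiPi :: "nat \<Rightarrow> nat \<Rightarrow> ('a::field, 'a mat) lsa" where
  "oo_PiPi a b = mat_lsa a b (\<lambda>X. transpose_mat X * gram a b + gram a b * X = 0\<^sub>m (a + b) (a + b))"

definition o_Pi :: "nat \<Rightarrow> ('a::field, 'a mat) lsa" where
  "o_Pi m = oo_PiPi 0 m"

definition pe :: "nat \<Rightarrow> ('a::field, 'a mat) lsa" where
  "pe n = mat_lsa n n (\<lambda>X. transpose_mat X * Pi_mat (2 * n) + Pi_mat (2 * n) * X = 0\<^sub>m (2 * n) (2 * n))"

definition o_Pi_tilde :: "nat \<Rightarrow> 'a::field mat set" where
  "o_Pi_tilde m = {M \<in> carrier_mat m m. \<exists>c. transpose_mat M * Pi_mat m + Pi_mat m * M = c \<cdot>\<^sub>m Pi_mat m}"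

definition subspace_of :: "('k, 'v) lsa \<Rightarrow> 'v set \<Rightarrow> bool" where
  "subspace_of h V \<longleftrightarrow> V \<subseteq> lcar h \<and> lzero h \<in> V
     \<and> (\<forall>u \<in> V. \<forall>v \<in> V. ladd h u v \<in> V) \<and> (\<forall>c. \<forall>u \<in> V. lsmul h c u \<in> V)"

definition Z2_grading :: "('k, 'v) lsa \<Rightarrow> 'v set \<Rightarrow> 'v set \<Rightarrow> bool" where
  "Z2_grading g g0 g1 \<longleftrightarrow> subspace_of g g0 \<and> subspace_of g g1
     \<and> g0 \<inter> g1 = {lzero g}
     \<and> (\<forall>x \<in> lcar g. \<exists>x0 \<in> g0. \<exists>x1 \<in> g1. x = ladd g x0 x1)
     \<and> (\<forall>x \<in> g0. \<forall>y \<in> g0. lbr g x y \<in> g0)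
     \<and> (\<forall>x \<in> g0. \<forall>y \<in> g1. lbr g x y \<in> g1)
     \<and> (\<forall>x \<in> g1. \<forall>y \<in> g0. lbr g x y \<in> g1)
     \<and> (\<forall>x \<in> g1. \<forall>y \<in> g1. lbr g x y \<in> g0)"

text \<open>Linear maps on g are represented as functions, extended by zero outside lcar g.\<close>
definition is_derivation :: "('k, 'v) lsa \<Rightarrow> ('v \<Rightarrow> 'v) \<Rightarrow> bool" where
  "is_derivation g D \<longleftrightarrow> (\<forall>x. x \<notin> lcar g \<longrightarrow> D x = lzero g)
     \<and> (\<forall>x \<in> lcar g. D x \<in> lcar g)
     \<and> (\<forall>x \<in> lcar g. \<forall>y \<in> lcar g. D (ladd g x y) = ladd g (D x) (D y))
     \<and> (\<forall>c. \<forall>x \<in> lcar g. D (lsmul g c x) = lsmul g c (D x))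
     \<and> (\<forall>x \<in> lcar g. \<forall>y \<in> lcar g. D (lbr g x y) = ladd g (lbr g (D x) y) (lbr g x (D y)))"

definition ad :: "('k, 'v) lsa \<Rightarrow> 'v \<Rightarrow> 'v \<Rightarrow> 'v" where
  "ad g x = (\<lambda>y. if y \<in> lcar g then lbr g x y else lzero g)"

definition fun_add :: "('k, 'v) lsa \<Rightarrow> ('v \<Rightarrow> 'v) \<Rightarrow> ('v \<Rightarrow> 'v) \<Rightarrow> 'v \<Rightarrow> 'v" where
  "fun_add g D E = (\<lambda>y. ladd g (D y) (E y))"

definition fun_smul :: "('k, 'v) lsa \<Rightarrow> 'k \<Rightarrow> ('v \<Rightarrow> 'v) \<Rightarrow> 'v \<Rightarrow> 'v" where
  "fun_smul g c D = (\<lambda>y. lsmul g c (D y))"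

definition fun_br :: "('k::field, 'v) lsa \<Rightarrow> ('v \<Rightarrow> 'v) \<Rightarrow> ('v \<Rightarrow> 'v) \<Rightarrow> 'v \<Rightarrow> 'v" where
  "fun_br g D E = fun_add g (D \<circ> E) (fun_smul g (-1) (E \<circ> D))"

inductive_set g_one :: "('k::field, 'v) lsa \<Rightarrow> 'v set \<Rightarrow> ('v \<Rightarrow> 'v) set" for g g1 where
  g_one_ad: "x \<in> lcar g \<Longrightarrow> ad g x \<in> g_one g g1"
| g_one_sq: "x \<in> g1 \<Longrightarrow> ad g x \<circ> ad g x \<in> g_one g g1"
| g_one_zero: "(\<lambda>y. lzero g) \<in> g_one g g1"
| g_one_add: "D \<in> g_one g g1 \<Longrightarrow> E \<in> g_one g g1 \<Longrightarrow> fun_add g D E \<in> g_one g g1"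
| g_one_smul: "D \<in> g_one g g1 \<Longrightarrow> fun_smul g c D \<in> g_one g g1"
| g_one_br: "D \<in> g_one g g1 \<Longrightarrow> E \<in> g_one g g1 \<Longrightarrow> fun_br g D E \<in> g_one g g1"

definition S_g_one :: "('k::field, 'v) lsa \<Rightarrow> 'v set \<Rightarrow> 'v set \<Rightarrow> ('k, 'v \<Rightarrow> 'v) lsa" where
  "S_g_one g g0 g1 = \<lparr>
     lcar = g_one g g1,
     lev = {D \<in> g_one g g1. D ` g0 \<subseteq> g0 \<and> D ` g1 \<subseteq> g1},
     lodd = {D \<in> g_one g g1. D ` g0 \<subseteq> g1 \<and> D ` g1 \<subseteq> g0},
     lzero = (\<lambda>y. lzero g),
     ladd = fun_add g,
     lsmul = fun_smul g,
     lbr = fun_br g,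
     lsq = (\<lambda>D. D \<circ> D) \<rparr>"

end

theory Submission
  imports Defs "Jordan_Normal_Form.Determinant"
begin

text \<open>
  A grading of \<open>g\<close> is the same as the idempotent derivation \<open>D\<close> that vanishes on \<open>g0\<close> and is the
  identity on \<open>g1\<close>. Writing \<open>D\<close> as the commutator with a matrix \<open>M\<close>, idempotency of \<open>D\<close> makes
  \<open>M\<^sup>2 + M\<close> commute with \<open>o\<^sup>(\<^sup>2\<^sup>)\<close> modulo scalars, so it is a scalar, and after adding a scalar to \<open>M\<close>
  (here the field must be algebraically closed) \<open>M\<close> itself is idempotent. The multiplier \<open>c\<close> of \<open>M\<close> is
  then 0 or 1: in the first case kernel and image of \<open>M\<close> are orthogonal and nondegenerate, in the second
  they are isotropic and dual to each other. A Darboux basis adapted to \<open>M\<close> turns the grading into the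
  parity of supermatrices for \<open>oo\<close> or \<open>pe\<close> respectively.

  Odd elements \<open>X\<close> of these superalgebras have zero diagonal, hence are sums of elements of square zero,
  so that \<open>X\<^sup>2\<close> is a sum of commutators. Therefore squaring adds nothing to the derived algebras, and
  \<open>g\<^sup><\<^sup>1\<^sup>>\<close> is just \<open>ad g\<close>.
\<close>

section \<open>Matrix commutators in characteristic 2\<close>

text \<open>The Gram matrices of \<open>o_Pi\<close>, \<open>oo_PiPi\<close> and \<open>pe\<close>
  are all permutation matrices of involutions without fixed points, so one computation in terms of
  the involution covers them; \<open>pe n\<close> and \<open>o_Pi (2 * n)\<close> even share the
  matrix and differ only in parity. Characteristic 2 enters twice when a grading becomes a matrix:
  the projection to the odd part is a derivation because its defect on two odd elements is 2 [x, y],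
  and its idempotency becomes a condition on M * M because (ad M)^2 = ad (M * M). The obstacle is
  the center: what holds in the quotient holds for matrices only up to scalars. The Jacobi identity
  turns commuting with \<open>L2\<close> modulo the center into exact commuting with the derived
  algebra of \<open>L2\<close>, and that algebra still contains enough matrices to force a scalar
  once there are three pairs of basis vectors; this is the reason for n > 2. Since scalars are even,
  the ambiguity touches only the even component of a representative. The bound k <= n div 2 comes
  from M and M + 1 inducing the same derivation with kernel and image exchanged.\<close>

definition mcomm :: "'a::field mat \<Rightarrow> 'a mat \<Rightarrow> 'a mat" where
  "mcomm X Y = X * Y - Y * X"

text \<open>The purely Lie-theoretic derived algebra, without squares. The ambient
  \<open>mat_lsa 0 N\<close> only supplies the vector space operations for
  \<open>lspan\<close>.\<close>

definition mat_derived :: "nat \<Rightarrow> 'a::field mat set \<Rightarrow> 'a mat set" where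
  "mat_derived N C = lspan (mat_lsa 0 N (\<lambda>_. True)) {mcomm X Y | X Y. X \<in> C \<and> Y \<in> C}"

definition scalar_mats :: "nat \<Rightarrow> 'a::field mat set" where
  "scalar_mats N = {c \<cdot>\<^sub>m 1\<^sub>m N | c. True}"

lemma mat_lsa_simps [simp]:
  "lzero (mat_lsa a b P) = 0\<^sub>m (a + b) (a + b)"
  "ladd (mat_lsa a b P) = (+)"
  "lsmul (mat_lsa a b P) = (\<lambda>c X. c \<cdot>\<^sub>m X)"
  "lbr (mat_lsa a b P) = mcomm"
  "lsq (mat_lsa a b P) = (\<lambda>X. X * X)"
  "lcar (mat_lsa a b P) = {X \<in> carrier_mat (a + b) (a + b). P X}"
  by (simp_all add: mat_lsa_def Let_def mcomm_def fun_eq_iff)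

text \<open>A span sees only zero, sums and scalar multiples, which allows passing from
  \<open>h\<close> to another superalgebra with the same operations.\<close>

lemma lspan_mono:
  assumes "x \<in> lspan h S" "S \<subseteq> T"
    and "lzero h = lzero h'" "ladd h = ladd h'" "lsmul h = lsmul h'"
  shows "x \<in> lspan h' T"
  using assms(1)
proof induction
  case lspan_zero
  show ?case using assms(3) lspan.lspan_zero[of h'] by simp
next
  case (lspan_base x)
  then show ?case using assms(2) by (blast intro: lspan.lspan_base)
next
  case (lspan_add u v)
  then show ?case using assms(4) lspan.lspan_add[of u h' T v] by simp
next
  case (lspan_smul u c)
  then show ?case using assms(5) lspan.lspan_smul[of u h' T c] by simp
qed

text \<open>The parameter \<open>ty\<close> pins down the field type, which \<open>N\<close> alone
  does not mention.\<close>

locale char2_mat =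
  fixes N :: nat and ty :: "'a::field itself"
  assumes char2: "CHAR('a) = 2"
begin

abbreviation CM :: "'a mat set" where "CM \<equiv> carrier_mat N N"

lemma two_zero [simp]: "(x::'a) + x = 0"
  using uminus_CHAR_2[OF char2] by (metis add.right_inverse)

lemma two_zero_left [simp]: "(x::'a) + (x + y) = y"
  by (simp add: add.assoc[symmetric])

lemma minus_eq_plus: "(x::'a) - y = x + y"
  using minus_CHAR_2[OF char2] by simp

lemma uminus_eq: "- (x::'a) = x"
  using uminus_CHAR_2[OF char2] by simp

lemma mat_minus_eq_plus: "(X::'a mat) \<in> CM \<Longrightarrow> Y \<in> CM \<Longrightarrow> X - Y = X + Y"
  by (rule eq_matI) (auto simp: minus_eq_plus)

lemma mat_add_self [simp]: "(X::'a mat) \<in> CM \<Longrightarrow> X + X = 0\<^sub>m N N"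
  by (rule eq_matI) auto

lemma mat_add_self_left [simp]: "(X::'a mat) \<in> CM \<Longrightarrow> Y \<in> CM \<Longrightarrow> X + (X + Y) = Y"
  by (rule eq_matI) auto

lemma mat_add_assoc: "(X::'a mat) \<in> CM \<Longrightarrow> Y \<in> CM \<Longrightarrow> Z \<in> CM \<Longrightarrow> X + Y + Z = X + (Y + Z)"
  by (rule assoc_add_mat)

lemma mat_add_comm: "(X::'a mat) \<in> CM \<Longrightarrow> Y \<in> CM \<Longrightarrow> X + Y = Y + X"
  by (rule comm_add_mat)

lemma mat_add_left_comm: "(X::'a mat) \<in> CM \<Longrightarrow> Y \<in> CM \<Longrightarrow> Z \<in> CM \<Longrightarrow> X + (Y + Z) = Y + (X + Z)"
  by (metis mat_add_assoc mat_add_comm)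

lemmas mat_ac = mat_add_assoc mat_add_comm mat_add_left_comm

lemma mat_distrib:
  "(X::'a mat) \<in> CM \<Longrightarrow> Y \<in> CM \<Longrightarrow> Z \<in> CM \<Longrightarrow> (X + Y) * Z = X * Z + Y * Z"
  "(X::'a mat) \<in> CM \<Longrightarrow> Y \<in> CM \<Longrightarrow> Z \<in> CM \<Longrightarrow> Z * (X + Y) = Z * X + Z * Y"
  by (auto intro: add_mult_distrib_mat mult_add_distrib_mat)

lemma mat_mult_assoc:
  "(X::'a mat) \<in> CM \<Longrightarrow> Y \<in> CM \<Longrightarrow> Z \<in> CM \<Longrightarrow> X * Y * Z = X * (Y * Z)"
  by (rule assoc_mult_mat)

lemma mat_smult:
  "(X::'a mat) \<in> CM \<Longrightarrow> Y \<in> CM \<Longrightarrow> (c \<cdot>\<^sub>m X) * Y = c \<cdot>\<^sub>m (X * Y)"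
  "(X::'a mat) \<in> CM \<Longrightarrow> Y \<in> CM \<Longrightarrow> X * (c \<cdot>\<^sub>m Y) = c \<cdot>\<^sub>m (X * Y)"
  "(X::'a mat) \<in> CM \<Longrightarrow> Y \<in> CM \<Longrightarrow> c \<cdot>\<^sub>m (X + Y) = c \<cdot>\<^sub>m X + c \<cdot>\<^sub>m Y"
  by (auto intro: mult_smult_assoc_mat mult_smult_distrib add_smult_distrib_left_mat)

lemma mat_mult_closed [simp]: "(X::'a mat) \<in> CM \<Longrightarrow> Y \<in> CM \<Longrightarrow> X * Y \<in> CM"
  by (rule mult_carrier_mat)

lemma mcomm_eq: "(X::'a mat) \<in> CM \<Longrightarrow> Y \<in> CM \<Longrightarrow> mcomm X Y = X * Y + Y * X"
  by (simp add: mcomm_def mat_minus_eq_plus)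

lemma mcomm_closed [simp]: "(X::'a mat) \<in> CM \<Longrightarrow> Y \<in> CM \<Longrightarrow> mcomm X Y \<in> CM"
  by (simp add: mcomm_eq)

text \<open>Without signs, a commutator identity is proved by expanding into words and sorting the
  sum, so that equal words meet and cancel.\<close>

lemmas mat_calc = mcomm_eq mat_distrib mat_mult_assoc mat_smult mat_ac

lemma mcomm_add:
  "(X::'a mat) \<in> CM \<Longrightarrow> Y \<in> CM \<Longrightarrow> Z \<in> CM \<Longrightarrow> mcomm X (Y + Z) = mcomm X Y + mcomm X Z"
  "(X::'a mat) \<in> CM \<Longrightarrow> Y \<in> CM \<Longrightarrow> Z \<in> CM \<Longrightarrow> mcomm (X + Y) Z = mcomm X Z + mcomm Y Z"
  by (simp_all add: mat_calc)

lemma mcomm_smult: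
  "(X::'a mat) \<in> CM \<Longrightarrow> Y \<in> CM \<Longrightarrow> mcomm X (c \<cdot>\<^sub>m Y) = c \<cdot>\<^sub>m mcomm X Y"
  "(X::'a mat) \<in> CM \<Longrightarrow> Y \<in> CM \<Longrightarrow> mcomm (c \<cdot>\<^sub>m X) Y = c \<cdot>\<^sub>m mcomm X Y"
  by (simp_all add: mat_calc)

lemma mcomm_sym: "(X::'a mat) \<in> CM \<Longrightarrow> Y \<in> CM \<Longrightarrow> mcomm X Y = mcomm Y X"
  by (simp add: mat_calc)

lemma mcomm_jacobi:
  "(X::'a mat) \<in> CM \<Longrightarrow> Y \<in> CM \<Longrightarrow> Z \<in> CM \<Longrightarrow>
   mcomm X (mcomm Y Z) = mcomm (mcomm X Y) Z + mcomm Y (mcomm X Z)"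
  by (simp add: mat_calc)

text \<open>The middle word \<open>X * Y * X\<close> occurs twice and cancels. This makes the square
  of an inner map inner again.\<close>

lemma mcomm_twice: "(X::'a mat) \<in> CM \<Longrightarrow> Y \<in> CM \<Longrightarrow> mcomm X (mcomm X Y) = mcomm (X * X) Y"
  by (simp add: mat_calc)

lemma square_add:
  "(X::'a mat) \<in> CM \<Longrightarrow> Y \<in> CM \<Longrightarrow> (X + Y) * (X + Y) = X * X + Y * Y + mcomm X Y"
  by (simp add: mat_calc)

lemma mcomm_scalar:
  "(X::'a mat) \<in> CM \<Longrightarrow> mcomm (c \<cdot>\<^sub>m 1\<^sub>m N) X = 0\<^sub>m N N"
  "(X::'a mat) \<in> CM \<Longrightarrow> mcomm X (c \<cdot>\<^sub>m 1\<^sub>m N) = 0\<^sub>m N N"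
  by (simp_all add: mcomm_eq mat_smult)

lemma mcomm_zero [simp]:
  "(X::'a mat) \<in> CM \<Longrightarrow> mcomm (0\<^sub>m N N) X = 0\<^sub>m N N"
  "(X::'a mat) \<in> CM \<Longrightarrow> mcomm X (0\<^sub>m N N) = 0\<^sub>m N N"
  by (simp_all add: mcomm_eq)

lemma mat_add_eq_zero: "(X::'a mat) \<in> CM \<Longrightarrow> Y \<in> CM \<Longrightarrow> X + Y = 0\<^sub>m N N \<longleftrightarrow> X = Y"
  by (metis mat_add_self mat_add_self_left right_add_zero_mat)

lemma scalar_carrier [simp]: "Z \<in> scalar_mats N \<Longrightarrow> (Z::'a mat) \<in> CM"
  by (auto simp: scalar_mats_def)

lemma mcomm_scalar_mats: "Z \<in> scalar_mats N \<Longrightarrow> (X::'a mat) \<in> CM \<Longrightarrow> mcomm Z X = 0\<^sub>m N N"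
  by (auto simp: scalar_mats_def mcomm_scalar)

definition mat_subspace :: "'a mat set \<Rightarrow> bool" where
  "mat_subspace C \<longleftrightarrow> C \<subseteq> CM \<and> 0\<^sub>m N N \<in> C \<and> (\<forall>X\<in>C. \<forall>Y\<in>C. X + Y \<in> C) \<and> (\<forall>c. \<forall>X\<in>C. c \<cdot>\<^sub>m X \<in> C)"

lemma mat_derived_zero: "0\<^sub>m N N \<in> mat_derived N (C::'a mat set)"
  using lspan.lspan_zero[of "mat_lsa 0 N (\<lambda>_. True)"] by (simp add: mat_derived_def)

lemma mat_derived_add:
  "X \<in> mat_derived N (C::'a mat set) \<Longrightarrow> Y \<in> mat_derived N C \<Longrightarrow> X + Y \<in> mat_derived N C"
  using lspan.lspan_add[of X "mat_lsa 0 N (\<lambda>_. True)" _ Y] by (simp add: mat_derived_def)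

lemma mat_derived_smult:
  "X \<in> mat_derived N (C::'a mat set) \<Longrightarrow> c \<cdot>\<^sub>m X \<in> mat_derived N C"
  using lspan.lspan_smul[of X "mat_lsa 0 N (\<lambda>_. True)" _ c] by (simp add: mat_derived_def)

lemma mat_derived_mcomm:
  "X \<in> C \<Longrightarrow> Y \<in> C \<Longrightarrow> mcomm X Y \<in> mat_derived N (C::'a mat set)"
  unfolding mat_derived_def by (rule lspan.lspan_base) blast

lemma lspan_subset_subspace:
  assumes "x \<in> lspan h S" "mat_subspace C" "S \<subseteq> C"
    and "lzero h = 0\<^sub>m N N" "ladd h = (+)" "lsmul h = (\<lambda>c X. c \<cdot>\<^sub>m X)"
  shows "x \<in> C"
  using assms(1)
  by induction (use assms(2-) in \<open>auto simp: mat_subspace_def\<close>)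

lemma mat_derived_subset:
  assumes "mat_subspace C" "\<And>X Y. X \<in> D \<Longrightarrow> Y \<in> D \<Longrightarrow> mcomm X Y \<in> C"
  shows "mat_derived N D \<subseteq> C"
  using lspan_subset_subspace[of _ "mat_lsa 0 N (\<lambda>_. True)" "{mcomm X Y | X Y. X \<in> D \<and> Y \<in> D}" C] assms
  unfolding mat_derived_def by fastforce

lemma mat_subspace_CM: "mat_subspace CM"
  by (auto simp: mat_subspace_def)

lemma mat_derived_subspace:
  assumes "C \<subseteq> CM"
  shows "mat_subspace (mat_derived N C)"
  using mat_derived_subset[of CM C] assms mat_subspace_CM
  by (auto simp: mat_subspace_def mat_derived_zero mat_derived_add mat_derived_smult subsetD)

lemma mat_derived_mono: "C \<subseteq> D \<Longrightarrow> mat_derived N C \<subseteq> mat_derived N (D::'a mat set)"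
  unfolding mat_derived_def
  by (rule subsetI, erule lspan_mono) auto

end

section \<open>The orthogonal Lie algebra of an involution\<close>

definition form_lie :: "nat \<Rightarrow> 'a::field mat \<Rightarrow> 'a mat set" where
  "form_lie N G = {X \<in> carrier_mat N N. transpose_mat X * G + G * X = 0\<^sub>m N N}"

definition inv_mat :: "nat \<Rightarrow> (nat \<Rightarrow> nat) \<Rightarrow> 'a::field mat" where
  "inv_mat N \<sigma> = mat N N (\<lambda>(i, j). if j = \<sigma> i then 1 else 0)"

lemma inv_mat_carrier [simp]: "inv_mat N \<sigma> \<in> carrier_mat N N"
  by (simp add: inv_mat_def)

text \<open>As a simp rule this would turn entries of products into scalar products of rows and columns
  before \<open>mult_entry\<close> below applies.\<close>
declare index_mult_mat(1) [simp del]

text \<open>Absence of fixed points makes the symmetric form with Gram matrix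
  \<open>inv_mat N \<sigma>\<close> alternating. The bound 6 leaves an index outside any two orbits
  of \<open>\<sigma>\<close>.\<close>

locale involution_form = char2_mat N ty for N :: nat and ty :: "'a::field itself" +
  fixes \<sigma> :: "nat \<Rightarrow> nat"
  assumes \<sigma>_lt [simp]: "i < N \<Longrightarrow> \<sigma> i < N"
    and \<sigma>_\<sigma> [simp]: "i < N \<Longrightarrow> \<sigma> (\<sigma> i) = i"
    and \<sigma>_ne: "i < N \<Longrightarrow> \<sigma> i \<noteq> i"
    and N_ge: "6 \<le> N"
begin

abbreviation G :: "'a mat" where "G \<equiv> inv_mat N \<sigma>"
abbreviation L0 :: "'a mat set" where "L0 \<equiv> form_lie N G"
abbreviation L1 :: "'a mat set" where "L1 \<equiv> mat_derived N L0"
abbreviation L2 :: "'a mat set" where "L2 \<equiv> mat_derived N L1"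

lemma \<sigma>_ne' [simp]: "i < N \<Longrightarrow> i \<noteq> \<sigma> i" "i < N \<Longrightarrow> \<sigma> i \<noteq> i"
  using \<sigma>_ne[of i] by auto

lemma \<sigma>_inj [simp]: "i < N \<Longrightarrow> j < N \<Longrightarrow> \<sigma> i = \<sigma> j \<longleftrightarrow> i = j"
  by (metis \<sigma>_\<sigma>)

lemma mult_entry:
  assumes "A \<in> CM" "B \<in> CM" "i < N" "j < N"
  shows "(A * B) $$ (i, j) = (\<Sum>k<N. A $$ (i, k) * B $$ (k, j))"
  using carrier_matD[OF assms(1)] carrier_matD[OF assms(2)] assms(3,4)
  by (simp add: index_mult_mat(1) scalar_prod_def atLeast0LessThan)

lemma add_entry:
  assumes "A \<in> CM" "B \<in> CM" "i < N" "j < N"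
  shows "(A + B) $$ (i, j) = A $$ (i, j) + B $$ (i, j)"
  using assms by simp

lemma transpose_entry: "A \<in> CM \<Longrightarrow> i < N \<Longrightarrow> j < N \<Longrightarrow> transpose_mat A $$ (i, j) = A $$ (j, i)"
  by simp

lemma mult_G_entry:
  assumes "A \<in> CM" "i < N" "j < N"
  shows "(A * G) $$ (i, j) = A $$ (i, \<sigma> j)" "(G * A) $$ (i, j) = A $$ (\<sigma> i, j)"
proof -
  have "(A * G) $$ (i, j) = (\<Sum>k<N. A $$ (i, k) * G $$ (k, j))"
    using assms by (simp add: mult_entry)
  also have "\<dots> = (\<Sum>k<N. if k = \<sigma> j then A $$ (i, k) else 0)"
    by (rule sum.cong) (use assms in \<open>auto simp: inv_mat_def\<close>)
  finally have "(A * G) $$ (i, j) = (\<Sum>k<N. if k = \<sigma> j then A $$ (i, k) else 0)" .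
  then show "(A * G) $$ (i, j) = A $$ (i, \<sigma> j)" using assms by simp
  have "(G * A) $$ (i, j) = (\<Sum>k<N. G $$ (i, k) * A $$ (k, j))"
    using assms by (simp add: mult_entry)
  also have "\<dots> = (\<Sum>k<N. if k = \<sigma> i then A $$ (k, j) else 0)"
    by (rule sum.cong) (use assms in \<open>auto simp: inv_mat_def\<close>)
  finally have "(G * A) $$ (i, j) = (\<Sum>k<N. if k = \<sigma> i then A $$ (k, j) else 0)" .
  then show "(G * A) $$ (i, j) = A $$ (\<sigma> i, j)" using assms by simp
qed

text \<open>Multiplication by \<open>G\<close> permutes rows or columns, and the sign disappears in
  characteristic 2. What remains is symmetry under the reflection of positions (i, j) to (\<sigma>
  j, \<sigma> i), whose fixed positions are (i, \<sigma> i).\<close>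

lemma L0_iff: "X \<in> L0 \<longleftrightarrow> X \<in> CM \<and> (\<forall>i<N. \<forall>j<N. X $$ (\<sigma> j, \<sigma> i) = X $$ (i, j))"
proof (cases "X \<in> CM")
  case True
  then have XT: "transpose_mat X \<in> CM" by simp
  have entry: "(transpose_mat X * G + G * X) $$ (i, j) = X $$ (\<sigma> j, i) + X $$ (\<sigma> i, j)"
    if "i < N" "j < N" for i j
    using True XT that by (simp add: add_entry mult_G_entry transpose_entry del: index_add_mat)
  have "transpose_mat X * G + G * X = 0\<^sub>m N N \<longleftrightarrow> (\<forall>i<N. \<forall>j<N. X $$ (\<sigma> j, i) + X $$ (\<sigma> i, j) = 0)"
    (is "?L \<longleftrightarrow> ?R")
  proof
    assume ?L
    then show ?R using entry by (metis index_zero_mat(1))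
  next
    assume ?R
    then show ?L using entry True XT inv_mat_carrier[of N \<sigma>] by (intro eq_matI) (auto simp del: inv_mat_carrier)
  qed
  also have "\<dots> \<longleftrightarrow> (\<forall>i<N. \<forall>j<N. X $$ (\<sigma> j, i) = X $$ (\<sigma> i, j))"
    by (metis two_zero two_zero_left add.right_neutral)
  also have "\<dots> \<longleftrightarrow> (\<forall>i<N. \<forall>j<N. X $$ (\<sigma> j, \<sigma> i) = X $$ (i, j))"
    by (metis \<sigma>_lt \<sigma>_\<sigma>)
  finally show ?thesis using True by (simp add: form_lie_def)
qed (simp add: form_lie_def)

lemma L0_sym: "X \<in> L0 \<Longrightarrow> i < N \<Longrightarrow> j < N \<Longrightarrow> X $$ (\<sigma> j, \<sigma> i) = X $$ (i, j)"
  by (simp add: L0_iff)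

lemma L0_sym': "X \<in> L0 \<Longrightarrow> i < N \<Longrightarrow> j < N \<Longrightarrow> X $$ (j, \<sigma> i) = X $$ (i, \<sigma> j)"
  using L0_sym[of X i "\<sigma> j"] \<sigma>_\<sigma>[of j] \<sigma>_lt[of j] by metis

lemma L0_carrier [simp]: "X \<in> L0 \<Longrightarrow> X \<in> CM"
  by (simp add: L0_iff)

section \<open>Matrix units and their symmetrisations\<close>

definition E :: "nat \<Rightarrow> nat \<Rightarrow> 'a mat" where
  "E i j = mat N N (\<lambda>(a, b). if a = i \<and> b = j then 1 else 0)"

text \<open>A matrix unit plus its mirror image under the reflection in \<open>L0_iff\<close>. At a
  fixed position, \<open>j = \<sigma> i\<close>, the two coincide and \<open>F i j\<close> is zero;
  there \<open>E i (\<sigma> i)\<close> takes its place.\<close>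

definition F :: "nat \<Rightarrow> nat \<Rightarrow> 'a mat" where
  "F i j = E i j + E (\<sigma> j) (\<sigma> i)"

lemma E_carrier [simp]: "E i j \<in> CM"
  by (simp add: E_def)

lemma F_carrier [simp]: "F i j \<in> CM"
  by (simp add: F_def)

lemma E_entry: "a < N \<Longrightarrow> b < N \<Longrightarrow> E i j $$ (a, b) = of_bool (a = i \<and> b = j)"
  unfolding E_def by (simp only: index_mat of_bool_def prod.case)

lemma F_entry:
  assumes "a < N" "b < N"
  shows "F i j $$ (a, b) = of_bool (a = i \<and> b = j) + of_bool (a = \<sigma> j \<and> b = \<sigma> i)"
  unfolding F_def add_entry[OF E_carrier E_carrier assms] E_entry[OF assms] ..

lemma E_mult: "j < N \<Longrightarrow> E i j * E k l = (if j = k then E i l else 0\<^sub>m N N)"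
proof (rule eq_matI)
  fix a b
  assume j: "j < N" and "a < dim_row (if j = k then E i l else 0\<^sub>m N N)"
    "b < dim_col (if j = k then E i l else 0\<^sub>m N N)"
  then have ab: "a < N" "b < N" by (auto simp: E_def split: if_splits)
  have "(E i j * E k l) $$ (a, b) = (\<Sum>m<N. E i j $$ (a, m) * E k l $$ (m, b))"
    using ab by (simp add: mult_entry)
  also have "\<dots> = (\<Sum>m<N. if m = j then (if a = i \<and> j = k \<and> b = l then 1 else 0) else 0)"
    by (rule sum.cong) (use ab in \<open>auto simp: E_def\<close>)
  finally have "(E i j * E k l) $$ (a, b) =
    (\<Sum>m<N. if m = j then (if a = i \<and> j = k \<and> b = l then 1 else 0) else 0)" .
  then show "(E i j * E k l) $$ (a, b) = (if j = k then E i l else 0\<^sub>m N N) $$ (a, b)"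
    using ab j by (auto simp: E_def)
qed (auto simp: E_def)

lemma L0_subspace: "mat_subspace L0"
  unfolding mat_subspace_def
proof (intro conjI ballI allI)
  fix X Y and c :: 'a assume X: "X \<in> L0" and Y: "Y \<in> L0"
  show "X + Y \<in> L0"
    using L0_carrier[OF X] L0_carrier[OF Y] unfolding L0_iff[of "X + Y"]
    by (simp add: L0_sym[OF X] L0_sym[OF Y])
  show "c \<cdot>\<^sub>m X \<in> L0"
    using L0_carrier[OF X] unfolding L0_iff[of "c \<cdot>\<^sub>m X"] by (simp add: L0_sym[OF X])
qed (auto simp: L0_iff)

lemma L0_mcomm:
  assumes "X \<in> L0" "Y \<in> L0"
  shows "mcomm X Y \<in> L0"
proof -
  have XY: "X \<in> CM" "Y \<in> CM" using assms by (auto simp: L0_iff)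
  \<comment> \<open>The reflection reverses products, hence exchanges the two terms of a
    commutator.\<close>
  have sym: "(A * B) $$ (i, j) = (B * A) $$ (\<sigma> j, \<sigma> i)"
    if A: "A \<in> L0" and B: "B \<in> L0" and ij: "i < N" "j < N" for A B i j
  proof -
    have "(A * B) $$ (i, j) = (\<Sum>k<N. B $$ (\<sigma> j, \<sigma> k) * A $$ (\<sigma> k, \<sigma> i))"
      using A B ij by (auto simp: mult_entry L0_sym mult.commute intro!: sum.cong)
    also have "\<dots> = (\<Sum>k<N. B $$ (\<sigma> j, k) * A $$ (k, \<sigma> i))"
      by (rule sum.reindex_bij_witness[of _ \<sigma> \<sigma>]) auto
    finally show ?thesis using A B ij by (simp add: mult_entry)
  qed
  show ?thesis
    unfolding L0_iff
  proof (intro conjI allI impI)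
    fix i j assume ij: "i < N" "j < N"
    have "mcomm X Y $$ (a, b) = (X * Y) $$ (a, b) + (Y * X) $$ (a, b)" if "a < N" "b < N" for a b
      using XY that by (simp add: mcomm_eq add_entry del: index_add_mat)
    then show "mcomm X Y $$ (\<sigma> j, \<sigma> i) = mcomm X Y $$ (i, j)"
      using sym[OF assms ij] sym[OF assms(2,1) ij] ij by (simp add: add.commute)
  qed (use XY in simp)
qed

lemma L1_subset_L0: "L1 \<subseteq> L0"
  by (rule mat_derived_subset) (auto intro: L0_subspace L0_mcomm)

lemma L2_subset_L1: "L2 \<subseteq> L1"
  by (rule mat_derived_mono[OF L1_subset_L0])

lemma L0_CM: "L0 \<subseteq> CM"
  by (auto simp: L0_iff)

lemma L1_subspace: "mat_subspace L1"
  by (rule mat_derived_subspace[OF L0_CM])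

lemma L1_CM: "L1 \<subseteq> CM"
  using L1_subset_L0 L0_CM by blast

lemma L2_subspace: "mat_subspace L2"
  by (rule mat_derived_subspace[OF L1_CM])

lemma L2_CM: "L2 \<subseteq> CM"
  using L2_subset_L1 L1_CM by blast

lemma L2_mcomm: "X \<in> L2 \<Longrightarrow> Y \<in> L2 \<Longrightarrow> mcomm X Y \<in> L2"
  using L2_subset_L1 by (blast intro: mat_derived_mcomm)

text \<open>For \<open>X\<close> in \<open>L0\<close> the matrix \<open>G * X\<close> is symmetric;
  for commutators it is even alternating, because the entries of \<open>X * Y\<close> and
  \<open>Y * X\<close> at (i, \<sigma> i) are the same sum reindexed by
  \<open>\<sigma>\<close>.\<close>

lemma L1_alternating:
  assumes "X \<in> L1" "i < N"
  shows "X $$ (i, \<sigma> i) = 0"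
proof -
  let ?A = "{X \<in> CM. \<forall>i<N. X $$ (i, \<sigma> i) = 0}"
  have "L1 \<subseteq> ?A"
  proof (rule mat_derived_subset)
    show "mat_subspace ?A"
      unfolding mat_subspace_def by (intro conjI ballI allI) auto
    fix X Y assume XY: "X \<in> L0" "Y \<in> L0"
    then have C: "X \<in> CM" "Y \<in> CM" by simp_all
    have "mcomm X Y $$ (i, \<sigma> i) = 0" if i: "i < N" for i
    proof -
      have "(X * Y) $$ (i, \<sigma> i) = (\<Sum>k<N. X $$ (i, k) * Y $$ (k, \<sigma> i))"
        using C i by (simp add: mult_entry)
      also have "\<dots> = (\<Sum>k<N. X $$ (i, k) * Y $$ (i, \<sigma> k))"
        by (rule sum.cong) (simp_all only: lessThan_iff L0_sym'[OF XY(2) i])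
      also have "\<dots> = (\<Sum>k<N. X $$ (i, \<sigma> k) * Y $$ (i, k))"
        by (rule sum.reindex_bij_witness[of _ \<sigma> \<sigma>]) simp_all
      also have "\<dots> = (\<Sum>k<N. Y $$ (i, k) * X $$ (k, \<sigma> i))"
        by (rule sum.cong) (simp_all only: lessThan_iff L0_sym'[OF XY(1) i] mult.commute)
      also have "\<dots> = (Y * X) $$ (i, \<sigma> i)"
        using C i by (simp add: mult_entry)
      finally show ?thesis using C i by (simp add: mcomm_eq)
    qed
    then show "mcomm X Y \<in> ?A" using mcomm_closed[OF C] by blast
  qed
  from subsetD[OF this assms(1)] assms(2) show ?thesis by simp
qed

lemma E_L0:
  assumes i: "i < N"
  shows "E i (\<sigma> i) \<in> L0"
  unfolding L0_iff
proof (intro conjI allI impI)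
  fix a b assume "a < N" "b < N"
  then show "E i (\<sigma> i) $$ (\<sigma> b, \<sigma> a) = E i (\<sigma> i) $$ (a, b)"
    using i \<sigma>_inj[of a i] by (simp add: E_def) (metis \<sigma>_\<sigma>)
qed simp

lemma F_L0:
  assumes ij: "i < N" "j < N"
  shows "F i j \<in> L0"
  unfolding L0_iff
proof (intro conjI allI impI)
  fix a b assume ab: "a < N" "b < N"
  have "(\<sigma> b = i) = (b = \<sigma> i)" "(\<sigma> a = j) = (a = \<sigma> j)" "(\<sigma> b = \<sigma> j) = (b = j)" "(\<sigma> a = \<sigma> i) = (a = i)"
    using ij ab by (metis \<sigma>_\<sigma>)+
  then have "F i j $$ (\<sigma> b, \<sigma> a) = of_bool (b = \<sigma> i \<and> a = \<sigma> j) + of_bool (b = j \<and> a = i)"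
    using F_entry[OF \<sigma>_lt[OF ab(2)] \<sigma>_lt[OF ab(1)]] by (simp only:)
  then show "F i j $$ (\<sigma> b, \<sigma> a) = F i j $$ (a, b)"
    unfolding F_entry[OF ab] by (simp only: conj_commute add.commute)
qed simp

lemma F_diag_L1: "i < N \<Longrightarrow> F i i \<in> L1"
proof -
  assume i: "i < N"
  then have "F i i = mcomm (E i (\<sigma> i)) (E (\<sigma> i) i)"
    by (simp add: mcomm_eq F_def E_mult)
  then show ?thesis
    using mat_derived_mcomm[OF E_L0[OF i] E_L0[of "\<sigma> i"]] i by simp
qed

text \<open>\<open>F i i\<close> is diagonal with ones at \<open>i\<close> and
  \<open>\<sigma> i\<close>. It fixes the first unit of \<open>F i j\<close> from the left and the
  second from the right, so \<open>F i j\<close> is its own commutator with \<open>F i i\<close> and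
  survives passing to derived algebras.\<close>

lemma F_eq_mcomm_diag:
  assumes "i < N" "j < N" "i \<noteq> j" "j \<noteq> \<sigma> i"
  shows "F i j = mcomm (F i i) (F i j)"
proof -
  have "\<sigma> j \<noteq> i" "i \<noteq> \<sigma> j" using assms by (metis \<sigma>_\<sigma>)+
  then show ?thesis using assms
    by (simp add: mcomm_eq F_def E_mult mat_distrib)
qed

text \<open>A replacement for \<open>F_eq_mcomm_diag\<close> one level further down:
  \<open>F i i\<close> is only placed in \<open>L1\<close>, whereas both factors here can be taken
  from \<open>L2\<close>.\<close>

lemma F_eq_mcomm:
  assumes ijk: "i < N" "j < N" "k < N"
    and ne: "i \<noteq> j" "j \<noteq> \<sigma> i" "k \<noteq> i" "k \<noteq> \<sigma> i" "k \<noteq> j" "k \<noteq> \<sigma> j"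
  shows "F i j = mcomm (F i k) (F k j)"
proof -
  have ne': "\<sigma> j \<noteq> i" "\<sigma> k \<noteq> i" "\<sigma> k \<noteq> j" "\<sigma> i \<noteq> k" "\<sigma> j \<noteq> k" "\<sigma> i \<noteq> \<sigma> j" "\<sigma> i \<noteq> \<sigma> k"
    using ijk ne by (metis \<sigma>_\<sigma>)+
  have "F i k * F k j = E i j"
    by (simp add: F_def mat_distrib E_mult ijk ne[symmetric] ne'[symmetric] ne ne')
  moreover have "F k j * F i k = E (\<sigma> j) (\<sigma> i)"
    by (simp add: F_def mat_distrib E_mult ijk ne[symmetric] ne'[symmetric] ne ne')
  ultimately show ?thesis
    by (simp add: mcomm_eq F_def)
qed

lemma F_L1: "i < N \<Longrightarrow> j < N \<Longrightarrow> i \<noteq> j \<Longrightarrow> j \<noteq> \<sigma> i \<Longrightarrow> F i j \<in> L1"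
  using F_eq_mcomm_diag mat_derived_mcomm[OF F_L0 F_L0] by metis

lemma F_L2: "i < N \<Longrightarrow> j < N \<Longrightarrow> i \<noteq> j \<Longrightarrow> j \<noteq> \<sigma> i \<Longrightarrow> F i j \<in> L2"
  using F_eq_mcomm_diag mat_derived_mcomm[OF F_diag_L1 F_L1] by metis

lemma E_sq: "i < N \<Longrightarrow> j < N \<Longrightarrow> i \<noteq> j \<Longrightarrow> E i j * E i j = 0\<^sub>m N N"
  by (simp add: E_mult)

lemma F_sq: "i < N \<Longrightarrow> j < N \<Longrightarrow> i \<noteq> j \<Longrightarrow> F i j * F i j = 0\<^sub>m N N"
  by (simp add: F_def E_mult mat_distrib)

lemma smult_sq: "A \<in> CM \<Longrightarrow> A * A = 0\<^sub>m N N \<Longrightarrow> (c \<cdot>\<^sub>m A) * (c \<cdot>\<^sub>m A) = 0\<^sub>m N N"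
  by (simp add: mat_smult)

text \<open>Induction on the size of the support of \<open>X\<close>: subtracting a multiple \<open>T\<close> of some \<open>E\<close> or \<open>F\<close>,
  which has square zero, changes the square of \<open>X\<close> only by a commutator with \<open>T\<close>.\<close>
lemma square_in_derived:
  assumes K: "mat_subspace K" "K \<subseteq> L0"
    and EK: "\<And>i Y. i < N \<Longrightarrow> Y \<in> K \<Longrightarrow> Y $$ (i, \<sigma> i) \<noteq> 0 \<Longrightarrow> E i (\<sigma> i) \<in> K"
    and FK: "\<And>i j. i < N \<Longrightarrow> j < N \<Longrightarrow> i \<noteq> j \<Longrightarrow> j \<noteq> \<sigma> i \<Longrightarrow> F i j \<in> K"
    and X: "X \<in> K" "\<And>i. i < N \<Longrightarrow> X $$ (i, i) = 0"
  shows "X * X \<in> mat_derived N K"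
  using X
proof (induction "card {(i, j). i < N \<and> j < N \<and> X $$ (i, j) \<noteq> 0}" arbitrary: X rule: less_induct)
  case less
  let ?S = "\<lambda>X::'a mat. {(i, j). i < N \<and> j < N \<and> X $$ (i, j) \<noteq> 0}"
  have fin: "finite (?S X)" by (rule finite_subset[of _ "{..<N} \<times> {..<N}"]) auto
  have XC: "X \<in> CM" and XL: "X \<in> L0" using less.prems K by (auto simp: mat_subspace_def)
  show ?case
  proof (cases "?S X = {}")
    case True
    then have "X = 0\<^sub>m N N" using XC by (intro eq_matI) auto
    then show ?thesis by (simp add: mat_derived_zero)
  next
    case False
    then obtain i j where ij: "i < N" "j < N" "X $$ (i, j) \<noteq> 0" by auto
    have ne: "i \<noteq> j" using ij less.prems by auto
    \<comment> \<open>A position fixed by the reflection needs the single unit \<open>E\<close>,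
      since \<open>F\<close> vanishes there.\<close>
    define A where "A = (if j = \<sigma> i then E i (\<sigma> i) else F i j)"
    define T where "T = X $$ (i, j) \<cdot>\<^sub>m A"
    have AK: "A \<in> K" using EK FK ij ne less.prems by (auto simp: A_def)
    then have TK: "T \<in> K" using K by (auto simp: T_def mat_subspace_def)
    have AC: "A \<in> CM" by (simp add: A_def)
    then have TC: "T \<in> CM" by (simp add: T_def)
    have T2: "T * T = 0\<^sub>m N N"
      unfolding T_def using ij ne AC by (intro smult_sq) (auto simp: A_def E_sq F_sq)
    define Y where "Y = X + T"
    have YK: "Y \<in> K" using less.prems TK K by (auto simp: Y_def mat_subspace_def)
    have YC: "Y \<in> CM" using XC TC by (simp add: Y_def)
    \<comment> \<open>The mirror position carries the same value, so one multiple of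
      \<open>A\<close> clears both and creates no new entry.\<close>
    have Xsym: "X $$ (\<sigma> j, \<sigma> i) = X $$ (i, j)" using L0_sym[OF XL ij(1,2)] .
    have Yent: "Y $$ (a, b) = (if (a, b) = (i, j) \<or> (a, b) = (\<sigma> j, \<sigma> i) then 0 else X $$ (a, b))"
      if "a < N" "b < N" for a b
      using that ij Xsym XC AC ne
      by (auto simp: Y_def T_def A_def F_def E_def)
    have "?S Y \<subset> ?S X"
    proof
      show "?S Y \<subseteq> ?S X" using Yent by (auto split: if_splits)
      show "?S Y \<noteq> ?S X" using Yent[of i j] ij by auto
    qed
    then have "card (?S Y) < card (?S X)" using fin by (rule psubset_card_mono[rotated])
    moreover have "Y $$ (a, a) = 0" if "a < N" for a using Yent that less.prems by simp
    ultimately have IH: "Y * Y \<in> mat_derived N K" using less.hyps YK by blast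
    have "X = Y + T" using XC TC by (simp add: Y_def mat_ac)
    then have "X * X = Y * Y + mcomm Y T"
      using YC TC T2 by (simp add: square_add)
    then show ?thesis
      using IH mat_derived_mcomm[OF YK TK] by (simp add: mat_derived_add)
  qed
qed

lemma L0_square: "X \<in> L0 \<Longrightarrow> (\<And>i. i < N \<Longrightarrow> X $$ (i, i) = 0) \<Longrightarrow> X * X \<in> L1"
  using square_in_derived[OF L0_subspace] E_L0 F_L0 by blast

text \<open>The hypothesis on \<open>E\<close> in \<open>square_in_derived\<close> is vacuous here:
  entries at fixed positions vanish by \<open>L1_alternating\<close>.\<close>

lemma L1_square: "X \<in> L1 \<Longrightarrow> (\<And>i. i < N \<Longrightarrow> X $$ (i, i) = 0) \<Longrightarrow> X * X \<in> L2"
  using square_in_derived[OF L1_subspace L1_subset_L0] L1_alternating F_L1 by blast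

section \<open>Centralizers and the center\<close>

lemma exists_other:
  assumes "finite S" "card S < N"
  obtains k where "k < N" "k \<notin> S"
  using card_mono[OF assms(1), of "{..<N}"] assms(2) by auto

text \<open>Compare column \<open>j\<close> of both products. The only nonzero entry of
  \<open>F i j\<close> in that column is in row \<open>i\<close>, so multiplying by it from the
  right copies column \<open>i\<close> of \<open>M\<close> there.\<close>

lemma F_commutes_entry:
  assumes M: "M \<in> CM" and c: "mcomm M (F i j) = 0\<^sub>m N N"
    and ij: "i < N" "j < N" "i \<noteq> j" "j \<noteq> \<sigma> i" and a: "a < N"
  shows "M $$ (a, i) = (if a = i then M $$ (j, j) else if a = \<sigma> j then M $$ (\<sigma> i, j) else 0)"
proof -
  have "M * F i j = F i j * M" using c M by (simp add: mcomm_eq mat_add_eq_zero)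
  then have "(M * F i j) $$ (a, j) = (F i j * M) $$ (a, j)" by simp
  moreover have "(M * F i j) $$ (a, j) = (\<Sum>k<N. M $$ (a, k) * F i j $$ (k, j))"
    using M ij a by (simp add: mult_entry)
  moreover have "\<dots> = (\<Sum>k<N. if k = i then M $$ (a, k) else 0)"
    by (rule sum.cong) (use ij in \<open>auto simp: F_def E_def\<close>)
  moreover have "(F i j * M) $$ (a, j) = (\<Sum>k<N. F i j $$ (a, k) * M $$ (k, j))"
    using M ij a by (simp add: mult_entry)
  moreover have "\<dots> =
      (\<Sum>k<N. if k = (if a = i then j else \<sigma> i)
              then (if a = i then M $$ (k, j) else if a = \<sigma> j then M $$ (k, j) else 0) else 0)"
    by (rule sum.cong) (use ij a in \<open>auto simp: F_def E_def\<close>)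
  ultimately show ?thesis using ij a by (simp split: if_splits)
qed

text \<open>The algebra centralized is the derived algebra of \<open>L2\<close>, since
  \<open>mcomm_center_scalar\<close> can supply exact commutation only there. An index outside two
  orbits writes each off-diagonal \<open>F i j\<close> as a commutator inside
  \<open>L2\<close>.\<close>

lemma centralizer_scalar:
  assumes M: "M \<in> CM" and c: "\<And>X. X \<in> mat_derived N L2 \<Longrightarrow> mcomm M X = 0\<^sub>m N N"
  shows "M \<in> scalar_mats N"
proof -
  have cF: "mcomm M (F i j) = 0\<^sub>m N N" if ij: "i < N" "j < N" "i \<noteq> j" "j \<noteq> \<sigma> i" for i j
  proof -
    have "card {i, j, \<sigma> i, \<sigma> j} < N" using card_length[of "[i, j, \<sigma> i, \<sigma> j]"] N_ge by simp
    then obtain k where k: "k < N" "k \<notin> {i, j, \<sigma> i, \<sigma> j}" by (rule exists_other[rotated]) auto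
    have s: "\<sigma> k \<noteq> i" "\<sigma> k \<noteq> j" using k ij by (metis insertCI \<sigma>_\<sigma>)+
    have "F i j = mcomm (F i k) (F k j)" using F_eq_mcomm[of i j k] ij k by auto
    moreover have "F i k \<in> L2" "F k j \<in> L2" using F_L2[of i k] F_L2[of k j] ij k s by auto
    ultimately show ?thesis using c mat_derived_mcomm by metis
  qed
  note ent = F_commutes_entry[OF M cF]
  have off: "M $$ (a, i) = 0" if ai: "a < N" "i < N" "a \<noteq> i" for a i
  proof -
    \<comment> \<open>Avoiding \<open>\<sigma> a\<close> excludes the exceptional row
      \<open>a = \<sigma> j\<close> in \<open>ent\<close>; the row \<open>a = i\<close> is excluded
      by assumption.\<close>
    have "card {i, \<sigma> i, \<sigma> a} < N" using card_length[of "[i, \<sigma> i, \<sigma> a]"] N_ge by simp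
    then obtain j where j: "j < N" "j \<notin> {i, \<sigma> i, \<sigma> a}" by (rule exists_other[rotated]) auto
    then have "a \<noteq> \<sigma> j" by auto
    then show ?thesis using ent[of i j a] ai j by auto
  qed
  have diag: "M $$ (i, i) = M $$ (j, j)" if "i < N" "j < N" "i \<noteq> j" "j \<noteq> \<sigma> i" for i j
    using ent[of i j i] that by auto
  have diag': "M $$ (i, i) = M $$ (j, j)" if ij: "i < N" "j < N" for i j
  proof -
    \<comment> \<open>A third index bridges the case \<open>j = \<sigma> i\<close>, which
      \<open>diag\<close> does not reach.\<close>
    have "card {i, j, \<sigma> i, \<sigma> j} < N" using card_length[of "[i, j, \<sigma> i, \<sigma> j]"] N_ge by simp
    then obtain k where "k < N" "k \<notin> {i, j, \<sigma> i, \<sigma> j}" by (rule exists_other[rotated]) auto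
    then show ?thesis using diag[of i k] diag[of j k] ij by auto
  qed
  have "M = M $$ (0, 0) \<cdot>\<^sub>m 1\<^sub>m N"
  proof (rule eq_matI)
    fix i j assume "i < dim_row (M $$ (0, 0) \<cdot>\<^sub>m 1\<^sub>m N)" "j < dim_col (M $$ (0, 0) \<cdot>\<^sub>m 1\<^sub>m N)"
    then have ij: "i < N" "j < N" by simp_all
    show "M $$ (i, j) = (M $$ (0, 0) \<cdot>\<^sub>m 1\<^sub>m N) $$ (i, j)"
      using off[OF ij] diag'[OF ij(1), of 0] ij N_ge by (cases "i = j") simp_all
  qed (use M in simp_all)
  then show ?thesis unfolding scalar_mats_def by blast
qed

definition Z2 :: "'a mat set" where
  "Z2 = {Z \<in> L2. \<forall>X\<in>L2. mcomm Z X = 0\<^sub>m N N}"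

text \<open>By Jacobi, [M, [X, Y]] is the sum of [[M, X], Y] and [X, [M, Y]], and both vanish when
  [M, X] and [M, Y] are central. So commuting modulo the center is enough for being scalar.\<close>

lemma mcomm_center_scalar:
  assumes M: "M \<in> CM" and c: "\<And>X. X \<in> L2 \<Longrightarrow> mcomm M X \<in> Z2"
  shows "M \<in> scalar_mats N"
proof (rule centralizer_scalar[OF M])
  have "mat_derived N L2 \<subseteq> {X \<in> CM. mcomm M X = 0\<^sub>m N N}"
  proof (rule mat_derived_subset)
    show "mat_subspace {X \<in> CM. mcomm M X = 0\<^sub>m N N}"
      using M by (auto simp: mat_subspace_def mcomm_add mcomm_smult)
    fix X Y assume XY: "X \<in> L2" "Y \<in> L2"
    then have C: "X \<in> CM" "Y \<in> CM" using L2_CM by auto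
    have "mcomm (mcomm M X) Y = 0\<^sub>m N N" "mcomm (mcomm M Y) X = 0\<^sub>m N N"
      using c XY by (auto simp: Z2_def)
    then show "mcomm X Y \<in> {X \<in> CM. mcomm M X = 0\<^sub>m N N}"
      using mcomm_jacobi[OF M C] C M mcomm_sym[of X "mcomm M Y"] by simp
  qed
  then show "mcomm M X = 0\<^sub>m N N" if "X \<in> mat_derived N L2" for X using that by blast
qed

lemma Z2_eq: "Z2 = L2 \<inter> scalar_mats N"
proof
  have "0\<^sub>m N N \<in> Z2" using L2_CM by (auto simp: Z2_def mat_derived_zero)
  then show "Z2 \<subseteq> L2 \<inter> scalar_mats N"
    using mcomm_center_scalar L2_CM by (auto simp: Z2_def)
  show "L2 \<inter> scalar_mats N \<subseteq> Z2" using L2_CM by (auto simp: Z2_def mcomm_scalar_mats)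
qed

end

section \<open>Derived superalgebras and central quotients\<close>

text \<open>The part of \<open>mat_lsa\<close> that \<open>derived\<close> leaves alone: passing to
  a derived algebra only shrinks the carrier and its two parity components.\<close>

definition mat_ops :: "nat \<Rightarrow> ('a::field, 'a mat) lsa \<Rightarrow> bool" where
  "mat_ops N h \<longleftrightarrow> lzero h = 0\<^sub>m N N \<and> ladd h = (+) \<and> lsmul h = (\<lambda>c X. c \<cdot>\<^sub>m X)
     \<and> lbr h = mcomm \<and> lsq h = (\<lambda>X. X * X)"

lemma mat_opsD:
  assumes "mat_ops N h"
  shows "lzero h = 0\<^sub>m N N" "ladd h = (+)" "lsmul h = (\<lambda>c X. c \<cdot>\<^sub>m X)"
    "lbr h = mcomm" "lsq h = (\<lambda>X. X * X)"
  using assms by (simp_all add: mat_ops_def)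

lemma mat_ops_mat_lsa: "mat_ops (a + b) (mat_lsa a b P)"
  by (simp add: mat_ops_def)

definition mat_ev :: "nat \<Rightarrow> nat \<Rightarrow> 'a::field mat set" where
  "mat_ev N a = {X. \<forall>i<N. \<forall>j<N. (i < a) \<noteq> (j < a) \<longrightarrow> X $$ (i, j) = 0}"

definition mat_odd :: "nat \<Rightarrow> nat \<Rightarrow> 'a::field mat set" where
  "mat_odd N a = {X. \<forall>i<N. \<forall>j<N. (i < a) = (j < a) \<longrightarrow> X $$ (i, j) = 0}"

lemma lev_lodd_mat_lsa:
  "lev (mat_lsa a b P) = lcar (mat_lsa a b P) \<inter> mat_ev (a + b) a"
  "lodd (mat_lsa a b P) = lcar (mat_lsa a b P) \<inter> mat_odd (a + b) a"
  by (auto simp: mat_lsa_def Let_def mat_ev_def mat_odd_def)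

context char2_mat
begin

text \<open>Once odd squares are sums of commutators, the carrier of the derived superalgebra no
  longer depends on the parity.\<close>

lemma derived_mat:
  assumes ops: "mat_ops N (h :: ('a, 'a mat) lsa)" and C: "lcar h \<subseteq> CM"
    and sq: "\<And>X. X \<in> lodd h \<Longrightarrow> X * X \<in> mat_derived N (lcar h)"
  shows "mat_ops N (derived h)" "lcar (derived h) = mat_derived N (lcar h)"
    "lev (derived h) = mat_derived N (lcar h) \<inter> lev h"
    "lodd (derived h) = mat_derived N (lcar h) \<inter> lodd h"
proof -
  note o = mat_opsD[OF ops]
  let ?S = "{lbr h x y | x y. x \<in> lcar h \<and> y \<in> lcar h} \<union> {lsq h x | x. x \<in> lodd h}"
  have "lspan h ?S = mat_derived N (lcar h)"
  proof (rule subset_antisym; rule subsetI)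
    fix x assume "x \<in> lspan h ?S"
    then show "x \<in> mat_derived N (lcar h)"
      by (rule lspan_subset_subspace[OF _ mat_derived_subspace[OF C]])
        (use sq in \<open>auto simp: o mat_derived_mcomm\<close>)
  next
    fix x assume "x \<in> mat_derived N (lcar h)"
    then show "x \<in> lspan h ?S"
      unfolding mat_derived_def by (rule lspan_mono) (auto simp: o)
  qed
  then show "mat_ops N (derived h)" "lcar (derived h) = mat_derived N (lcar h)"
    "lev (derived h) = mat_derived N (lcar h) \<inter> lev h"
    "lodd (derived h) = mat_derived N (lcar h) \<inter> lodd h"
    using o by (simp_all add: derived_def Let_def mat_ops_def)
qed

lemma conj_mcomm:
  assumes "P \<in> CM" "Q \<in> CM" "P * Q = 1\<^sub>m N" "(X::'a mat) \<in> CM" "Y \<in> CM"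
  shows "Q * mcomm X Y * P = mcomm (Q * X * P) (Q * Y * P)"
proof -
  have *: "Q * (X * (P * (Q * (Y * P)))) = Q * (X * (Y * P))" if "X \<in> CM" "Y \<in> CM" for X Y
    using assms(1-3) that by (metis left_mult_one_mat mat_mult_assoc mat_mult_closed)
  show ?thesis
    using assms *[of X Y] *[of Y X] by (simp add: mcomm_eq mat_distrib mat_mult_assoc)
qed

lemma conj_mult:
  assumes "P \<in> CM" "Q \<in> CM" "P * Q = 1\<^sub>m N" "(X::'a mat) \<in> CM" "Y \<in> CM"
  shows "Q * (X * Y) * P = (Q * X * P) * (Q * Y * P)"
  using assms by (smt (verit) left_mult_one_mat mat_mult_assoc mat_mult_closed)

lemma conj_inv:
  assumes "P \<in> CM" "Q \<in> CM" "P * Q = 1\<^sub>m N" "(X::'a mat) \<in> CM"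
  shows "P * (Q * X * P) * Q = X"
proof -
  have "P * (Q * X * P) * Q = (P * Q) * X * (P * Q)"
    using assms(1,2,4) by (simp add: mat_mult_assoc)
  then show ?thesis using assms by simp
qed

text \<open>When \<open>X\<close> is conjugated by \<open>P\<close> and \<open>G\<close> is changed
  by congruence, the defining expression of the Lie algebra is changed by congruence as well,
  because \<open>P * Q\<close> cancels in the middle.\<close>

lemma conj_form_lie:
  assumes "P \<in> CM" "Q \<in> CM" "P * Q = 1\<^sub>m N" "transpose_mat P * G * P = G'"
    and "(G::'a mat) \<in> CM" "X \<in> form_lie N G"
  shows "Q * X * P \<in> form_lie N G'"
proof -
  have X: "X \<in> CM" "transpose_mat X * G + G * X = 0\<^sub>m N N" using assms by (auto simp: form_lie_def)
  have T: "transpose_mat P \<in> CM" "transpose_mat Q \<in> CM" "transpose_mat X \<in> CM"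
    using assms X by auto
  have TQ: "transpose_mat Q * transpose_mat P = 1\<^sub>m N"
    using transpose_mult[of P N N Q N] assms by simp
  have "transpose_mat (Q * X * P) = transpose_mat P * (transpose_mat X * transpose_mat Q)"
    using assms X transpose_mult[of "Q * X" N N P N] transpose_mult[of Q N N X N] by simp
  then have "transpose_mat (Q * X * P) * G' = transpose_mat P * transpose_mat X * (transpose_mat Q * transpose_mat P) * G * P"
    using assms X(1) T by (simp add: mat_mult_assoc flip: assms(4))
  also have "\<dots> = transpose_mat P * (transpose_mat X * G) * P"
    using assms X(1) T by (simp add: TQ mat_mult_assoc)
  finally have 1: "transpose_mat (Q * X * P) * G' = transpose_mat P * (transpose_mat X * G) * P" .
  have "G' * (Q * X * P) = transpose_mat P * G * (P * Q) * X * P"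
    using assms(1,2,5) X(1) T by (simp add: mat_mult_assoc flip: assms(4))
  also have "\<dots> = transpose_mat P * (G * X) * P"
    using assms X(1) T by (simp add: mat_mult_assoc)
  finally have 2: "G' * (Q * X * P) = transpose_mat P * (G * X) * P" .
  have "transpose_mat (Q * X * P) * G' + G' * (Q * X * P) = transpose_mat P * (transpose_mat X * G + G * X) * P"
    unfolding 1 2 using assms X(1) T by (simp add: mat_distrib)
  also have "\<dots> = 0\<^sub>m N N" using X(2) T assms by simp
  finally show ?thesis using assms X by (simp add: form_lie_def)
qed

lemma conj_mat_derived:
  assumes PQ: "P \<in> CM" "Q \<in> CM" "P * Q = 1\<^sub>m N"
    and CC: "C \<subseteq> CM" "\<And>X. (X::'a mat) \<in> C \<Longrightarrow> Q * X * P \<in> C'" and "X \<in> mat_derived N C"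
  shows "Q * X * P \<in> mat_derived N C'"
proof -
  have "mat_derived N C \<subseteq> {X \<in> CM. Q * X * P \<in> mat_derived N C'}"
  proof (rule mat_derived_subset)
    have "Q * (X + Y) * P = Q * X * P + Q * Y * P" "Q * (c \<cdot>\<^sub>m X) * P = c \<cdot>\<^sub>m (Q * X * P)"
      if "X \<in> CM" "Y \<in> CM" for X Y c
      using that PQ by (simp_all add: mat_distrib mat_smult)
    then show "mat_subspace {X \<in> CM. Q * X * P \<in> mat_derived N C'}"
      using PQ by (auto simp: mat_subspace_def mat_derived_zero mat_derived_add mat_derived_smult)
    fix X Y assume "X \<in> C" "Y \<in> C"
    then show "mcomm X Y \<in> {X \<in> CM. Q * X * P \<in> mat_derived N C'}"
      using CC PQ conj_mcomm[OF PQ, of X Y] by (auto simp: mat_derived_mcomm subsetD)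
  qed
  then show ?thesis using assms by blast
qed

end

context involution_form
begin

text \<open>The carrier depends only on the form and \<open>a\<close> enters only through the
  intersections. Both squaring lemmas apply because odd matrices have zero diagonal.\<close>

lemma derived2_mat_lsa:
  assumes "a + b = N" and P: "{X \<in> CM. P X} = L0"
  defines "h \<equiv> derived (derived (mat_lsa a b P)) :: ('a, 'a mat) lsa"
  shows "mat_ops N h" "lcar h = L2" "lev h = L2 \<inter> mat_ev N a" "lodd h = L2 \<inter> mat_odd N a"
proof -
  define h0 :: "('a, 'a mat) lsa" where "h0 = mat_lsa a b P"
  have ops0: "mat_ops N h0" using mat_ops_mat_lsa[of a b P] assms by (simp add: h0_def)
  have car0: "lcar h0 = L0" using assms by (simp add: h0_def)
  have par0: "lev h0 = L0 \<inter> mat_ev N a" "lodd h0 = L0 \<inter> mat_odd N a"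
    unfolding h0_def lev_lodd_mat_lsa using assms by simp_all
  have diag: "X $$ (i, i) = 0" if "X \<in> mat_odd N a" "i < N" for X :: "'a mat" and i
    using that by (auto simp: mat_odd_def)
  note d1 = derived_mat[OF ops0, unfolded car0 par0, OF L0_CM]
  have sq0: "X * X \<in> L1" if "X \<in> L0 \<inter> mat_odd N a" for X
    using that by (auto intro: L0_square simp: diag)
  define h1 where "h1 = derived h0"
  have h1: "mat_ops N h1" "lcar h1 = L1" "lev h1 = L1 \<inter> mat_ev N a" "lodd h1 = L1 \<inter> mat_odd N a"
    using d1[OF sq0] L1_subset_L0 by (auto simp: h1_def)
  have sq1: "X * X \<in> L2" if "X \<in> L1 \<inter> mat_odd N a" for X
    using that by (auto intro: L1_square simp: diag)
  note d2 = derived_mat[OF h1(1), unfolded h1(2-4), OF L1_CM sq1]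
  have "h = derived h1" by (simp add: h_def h1_def h0_def)
  then show "mat_ops N h" "lcar h = L2" "lev h = L2 \<inter> mat_ev N a" "lodd h = L2 \<inter> mat_odd N a"
    using d2 L2_subset_L1 by auto
qed

lemma odd_square:
  assumes "X \<in> L2" "X \<in> mat_odd N a"
  shows "X * X \<in> L2"
  using assms L2_subset_L1 by (intro L1_square) (auto simp: mat_odd_def)

end

locale mat_lie = char2_mat N ty for N :: nat and ty :: "'a::field itself" +
  fixes h :: "('a, 'a mat) lsa"
  assumes ops: "mat_ops N h" and car: "mat_subspace (lcar h)"
    and br: "X \<in> lcar h \<Longrightarrow> Y \<in> lcar h \<Longrightarrow> mcomm X Y \<in> lcar h"
begin

lemmas o = mat_opsD[OF ops]

abbreviation Z where "Z \<equiv> center h"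
abbreviation K where "K \<equiv> coset h Z"
abbreviation q where "q \<equiv> quot h Z"

lemma car_CM [simp]: "X \<in> lcar h \<Longrightarrow> X \<in> CM"
  using car by (auto simp: mat_subspace_def)

lemma car_closed [simp]:
  "X \<in> lcar h \<Longrightarrow> Y \<in> lcar h \<Longrightarrow> X + Y \<in> lcar h"
  "X \<in> lcar h \<Longrightarrow> c \<cdot>\<^sub>m X \<in> lcar h" "0\<^sub>m N N \<in> lcar h"
  using car by (auto simp: mat_subspace_def)

lemma Z_iff: "X \<in> Z \<longleftrightarrow> X \<in> lcar h \<and> (\<forall>Y\<in>lcar h. mcomm X Y = 0\<^sub>m N N)"
  by (simp add: center_def o)

lemma Z_car [simp]: "X \<in> Z \<Longrightarrow> X \<in> lcar h"
  by (simp add: Z_iff)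

lemma Z_CM [simp]: "X \<in> Z \<Longrightarrow> X \<in> CM"
  by (rule car_CM[OF Z_car])

lemma Z_mcomm:
  "X \<in> Z \<Longrightarrow> Y \<in> lcar h \<Longrightarrow> mcomm X Y = 0\<^sub>m N N"
  "X \<in> Z \<Longrightarrow> Y \<in> lcar h \<Longrightarrow> mcomm Y X = 0\<^sub>m N N"
  unfolding Z_iff by (metis, metis car_CM mcomm_sym)

lemma Z_closed [simp]:
  "X \<in> Z \<Longrightarrow> Y \<in> Z \<Longrightarrow> X + Y \<in> Z" "X \<in> Z \<Longrightarrow> c \<cdot>\<^sub>m X \<in> Z" "0\<^sub>m N N \<in> Z"
  unfolding Z_iff[of "X + Y"] Z_iff[of "c \<cdot>\<^sub>m X"] Z_iff[of "0\<^sub>m N N"]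
  by (simp_all add: mcomm_add mcomm_smult Z_mcomm)

lemma Z_add_cancel: "X \<in> Z \<Longrightarrow> Y \<in> CM \<Longrightarrow> X + Y \<in> Z \<longleftrightarrow> Y \<in> Z"
  by (metis Z_CM Z_closed(1) mat_add_self_left)

lemma mem_K: "X \<in> CM \<Longrightarrow> Y \<in> K X \<longleftrightarrow> Y \<in> CM \<and> X + Y \<in> Z"
  unfolding coset_def o
  by (auto simp: mat_add_self_left) (metis mat_add_self_left)

lemma K_eq_iff: "X \<in> CM \<Longrightarrow> Y \<in> CM \<Longrightarrow> K X = K Y \<longleftrightarrow> X + Y \<in> Z"
proof
  assume XY: "X \<in> CM" "Y \<in> CM"
  show "X + Y \<in> Z" if "K X = K Y"
    using mem_K[OF XY(1), of Y] mem_K[OF XY(2), of Y] that XY by simp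
  assume s: "X + Y \<in> Z"
  have "X + W \<in> Z \<longleftrightarrow> Y + W \<in> Z" if "W \<in> CM" for W
  proof -
    have "(X + Y) + (X + W) = Y + W" using XY that by (simp add: mat_ac)
    then show ?thesis using Z_add_cancel[OF s, of "X + W"] XY that by simp
  qed
  then have "W \<in> K X \<longleftrightarrow> W \<in> K Y" for W by (auto simp only: mem_K XY)
  then show "K X = K Y" by blast
qed

text \<open>Operations on \<open>quot\<close> act on representatives chosen by \<open>SOME\<close>.
  All that is known of the choice is that it differs from \<open>X\<close> by a central element, and
  this suffices for the computations below.\<close>

lemma K_some:
  assumes "X \<in> lcar h"
  shows "(SOME x. x \<in> K X) \<in> lcar h" "X + (SOME x. x \<in> K X) \<in> Z"
proof -
  have "X \<in> K X" using assms by (simp add: mem_K)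
  then have *: "(SOME x. x \<in> K X) \<in> K X" by (rule someI)
  then show 1: "X + (SOME x. x \<in> K X) \<in> Z" using assms by (simp only: mem_K car_CM)
  have "(SOME x. x \<in> K X) \<in> CM" using * assms by (simp only: mem_K car_CM)
  then have "X + (X + (SOME x. x \<in> K X)) = (SOME x. x \<in> K X)" using assms by simp
  then show "(SOME x. x \<in> K X) \<in> lcar h" using car_closed(1)[OF assms Z_car[OF 1]] by simp
qed

lemma q_car: "lcar q = K ` lcar h"
  by (simp add: quot_def)

lemma q_zero: "lzero q = K (0\<^sub>m N N)"
  by (simp add: quot_def o)

lemma q_add:
  assumes "X \<in> lcar h" "Y \<in> lcar h"
  shows "ladd q (K X) (K Y) = K (X + Y)"
proof -
  note a = K_some[OF assms(1)] and b = K_some[OF assms(2)]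
  define x y where "x = (SOME x. x \<in> K X)" and "y = (SOME x. x \<in> K Y)"
  note ab = a[folded x_def] b[folded y_def]
  have "(X + x) + (Y + y) \<in> Z" using ab by simp
  moreover have "(X + x) + (Y + y) = (x + y) + (X + Y)" using ab assms by (simp add: mat_ac)
  ultimately have "K (x + y) = K (X + Y)" using ab assms by (subst K_eq_iff) simp_all
  then show ?thesis by (simp add: quot_def o x_def y_def)
qed

lemma q_smul:
  assumes "X \<in> lcar h"
  shows "lsmul q c (K X) = K (c \<cdot>\<^sub>m X)"
proof -
  define x where "x = (SOME x. x \<in> K X)"
  note ab = K_some[OF assms, folded x_def]
  have "c \<cdot>\<^sub>m (X + x) \<in> Z" using ab by simp
  moreover have "c \<cdot>\<^sub>m (X + x) = c \<cdot>\<^sub>m x + c \<cdot>\<^sub>m X" using ab assms by (simp add: mat_smult mat_ac)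
  ultimately have "K (c \<cdot>\<^sub>m x) = K (c \<cdot>\<^sub>m X)" using ab assms by (subst K_eq_iff) simp_all
  then show ?thesis by (simp add: quot_def o x_def)
qed

lemma q_br:
  assumes "X \<in> lcar h" "Y \<in> lcar h"
  shows "lbr q (K X) (K Y) = K (mcomm X Y)"
proof -
  define x y where "x = (SOME x. x \<in> K X)" and "y = (SOME x. x \<in> K Y)"
  note ab = K_some[OF assms(1), folded x_def] K_some[OF assms(2), folded y_def]
  have "mcomm (X + x) Y = 0\<^sub>m N N" "mcomm x (Y + y) = 0\<^sub>m N N" using ab assms Z_mcomm by auto
  then have "mcomm x Y = mcomm X Y" "mcomm x y = mcomm x Y"
    using ab assms by (simp_all add: mcomm_add mat_add_eq_zero)
  then show ?thesis by (simp add: quot_def o x_def y_def)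
qed

end

section \<open>Darboux bases adapted to an idempotent\<close>

context involution_form
begin

text \<open>The bilinear form with Gram matrix \<open>G\<close>. Vectors are functions of which only
  the values below \<open>N\<close> count, hence the bounds on indices in all later equations
  between vectors.\<close>

definition B :: "(nat \<Rightarrow> 'a) \<Rightarrow> (nat \<Rightarrow> 'a) \<Rightarrow> 'a" where
  "B x y = (\<Sum>i<N. x i * y (\<sigma> i))"

definition mv :: "'a mat \<Rightarrow> (nat \<Rightarrow> 'a) \<Rightarrow> nat \<Rightarrow> 'a" where
  "mv M x r = (\<Sum>s<N. M $$ (r, s) * x s)"

lemma sum_\<sigma>: "(\<Sum>i<N. f (\<sigma> i)) = (\<Sum>i<N. f i)"
  by (rule sum.reindex_bij_witness[of _ \<sigma> \<sigma>]) simp_all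

lemma B_sym: "B x y = B y x"
proof -
  have "B x y = (\<Sum>i<N. x (\<sigma> (\<sigma> i)) * y (\<sigma> i))"
    unfolding B_def by (rule sum.cong) simp_all
  also have "\<dots> = B y x"
    unfolding B_def using sum_\<sigma>[of "\<lambda>i. x (\<sigma> i) * y i"] by (simp add: mult.commute)
  finally show ?thesis .
qed

text \<open>The summands at \<open>i\<close> and \<open>\<sigma> i\<close> are equal and distinct in
  index, so they cancel in pairs.\<close>

lemma B_alternating: "B x x = 0"
proof -
  have "B x x = (\<Sum>i\<in>{i. i < N \<and> i < \<sigma> i}. x i * x (\<sigma> i)) + (\<Sum>i\<in>{i. i < N \<and> \<sigma> i < i}. x i * x (\<sigma> i))"
    unfolding B_def
    by (subst sum.union_disjoint[symmetric])
      (auto intro!: sum.cong simp: linorder_not_less le_less)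
  also have "(\<Sum>i\<in>{i. i < N \<and> \<sigma> i < i}. x i * x (\<sigma> i)) = (\<Sum>i\<in>{i. i < N \<and> i < \<sigma> i}. x i * x (\<sigma> i))"
    by (rule sum.reindex_bij_witness[of _ \<sigma> \<sigma>]) (auto simp: mult.commute)
  finally show ?thesis by simp
qed

lemma B_cong: "(\<And>i. i < N \<Longrightarrow> x i = x' i) \<Longrightarrow> (\<And>i. i < N \<Longrightarrow> y i = y' i) \<Longrightarrow> B x y = B x' y'"
  unfolding B_def by (rule sum.cong) simp_all

text \<open>The shape of the correction term that makes a vector orthogonal to the pairs already
  constructed in \<open>darboux_step\<close>.\<close>

lemma B_lincomb:
  "B (\<lambda>s. z s + (\<Sum>i<m. a i * u i s + b i * v i s)) y = B z y + (\<Sum>i<m. a i * B (u i) y + b i * B (v i) y)"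
proof -
  have "B (\<lambda>s. z s + (\<Sum>i<m. a i * u i s + b i * v i s)) y
    = B z y + (\<Sum>s<N. \<Sum>i<m. (a i * u i s + b i * v i s) * y (\<sigma> s))"
    unfolding B_def by (simp add: distrib_right sum.distrib sum_distrib_right)
  also have "(\<Sum>s<N. \<Sum>i<m. (a i * u i s + b i * v i s) * y (\<sigma> s)) = (\<Sum>i<m. a i * B (u i) y + b i * B (v i) y)"
    unfolding B_def by (subst sum.swap) (simp add: distrib_right sum.distrib sum_distrib_left mult.assoc)
  finally show ?thesis .
qed

lemma mv_lincomb:
  "mv M (\<lambda>s. z s + (\<Sum>i<m. a i * u i s + b i * v i s)) r = mv M z r + (\<Sum>i<m. a i * mv M (u i) r + b i * mv M (v i) r)"
proof -
  have "mv M (\<lambda>s. z s + (\<Sum>i<m. a i * u i s + b i * v i s)) r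
    = mv M z r + (\<Sum>s<N. \<Sum>i<m. M $$ (r, s) * (a i * u i s + b i * v i s))"
    unfolding mv_def by (simp add: distrib_left sum.distrib sum_distrib_left)
  also have "(\<Sum>s<N. \<Sum>i<m. M $$ (r, s) * (a i * u i s + b i * v i s)) = (\<Sum>i<m. a i * mv M (u i) r + b i * mv M (v i) r)"
    unfolding mv_def by (subst sum.swap) (simp add: distrib_left sum.distrib sum_distrib_left mult.left_commute)
  finally show ?thesis .
qed

lemma B_add: "B (\<lambda>s. x s + x' s) y = B x y + B x' y" "B x (\<lambda>s. y s + y' s) = B x y + B x y'"
  unfolding B_def by (simp_all add: distrib_left distrib_right sum.distrib)

lemma B_smult: "B (\<lambda>s. c * x s) y = c * B x y" "B x (\<lambda>s. c * y s) = c * B x y"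
  unfolding B_def by (simp_all add: sum_distrib_left mult_ac)

lemma mv_add: "mv M (\<lambda>s. x s + x' s) r = mv M x r + mv M x' r"
  unfolding mv_def by (simp add: distrib_left sum.distrib)

lemma mv_mult:
  assumes "A \<in> CM" "A' \<in> CM" "r < N"
  shows "mv A (mv A' x) r = mv (A * A') x r"
proof -
  have "mv A (mv A' x) r = (\<Sum>s<N. \<Sum>t<N. A $$ (r, s) * A' $$ (s, t) * x t)"
    unfolding mv_def by (simp add: sum_distrib_left mult.assoc)
  also have "\<dots> = (\<Sum>t<N. (\<Sum>s<N. A $$ (r, s) * A' $$ (s, t)) * x t)"
    by (subst sum.swap) (simp add: sum_distrib_right)
  also have "\<dots> = mv (A * A') x r"
    unfolding mv_def by (rule sum.cong) (use assms in \<open>simp_all add: mult_entry\<close>)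
  finally show ?thesis .
qed

lemma B_adjoint:
  assumes M: "M \<in> CM" and eq: "transpose_mat M * G + G * M = c \<cdot>\<^sub>m G"
  shows "B (mv M x) y + B x (mv M y) = c * B x y"
proof -
  have ent: "M $$ (\<sigma> t, s) + M $$ (\<sigma> s, t) = (if t = \<sigma> s then c else 0)" if "s < N" "t < N" for s t
  proof -
    have T: "transpose_mat M \<in> CM" using M by simp
    have "(transpose_mat M * G + G * M) $$ (s, t) = M $$ (\<sigma> t, s) + M $$ (\<sigma> s, t)"
      using M T that by (simp add: add_entry mult_G_entry transpose_entry del: index_add_mat)
    then show ?thesis using that unfolding eq by (cases "t = \<sigma> s") (simp_all add: inv_mat_def)
  qed
  have "B (mv M x) y = (\<Sum>t<N. (\<Sum>s<N. M $$ (\<sigma> (\<sigma> t), s) * x s) * y (\<sigma> t))"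
    unfolding B_def mv_def by (rule sum.cong) simp_all
  also have "\<dots> = (\<Sum>t<N. (\<Sum>s<N. M $$ (\<sigma> t, s) * x s) * y t)"
    by (rule sum_\<sigma>[of "\<lambda>t. (\<Sum>s<N. M $$ (\<sigma> t, s) * x s) * y t"])
  also have "\<dots> = (\<Sum>t<N. \<Sum>s<N. x s * y t * M $$ (\<sigma> t, s))"
    by (simp add: sum_distrib_right sum_distrib_left mult_ac)
  also have "\<dots> = (\<Sum>s<N. \<Sum>t<N. x s * y t * M $$ (\<sigma> t, s))"
    by (rule sum.swap)
  finally have 1: "B (mv M x) y = (\<Sum>s<N. \<Sum>t<N. x s * y t * M $$ (\<sigma> t, s))" .
  have 2: "B x (mv M y) = (\<Sum>s<N. \<Sum>t<N. x s * y t * M $$ (\<sigma> s, t))"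
    unfolding B_def mv_def by (simp add: sum_distrib_left mult_ac)
  have "B (mv M x) y + B x (mv M y) = (\<Sum>s<N. \<Sum>t<N. x s * y t * (M $$ (\<sigma> t, s) + M $$ (\<sigma> s, t)))"
    unfolding 1 2 by (simp add: sum.distrib[symmetric] distrib_left)
  also have "\<dots> = (\<Sum>s<N. \<Sum>t<N. if t = \<sigma> s then x s * y t * c else 0)"
    by (intro sum.cong) (simp_all add: ent)
  also have "\<dots> = c * B x y"
    unfolding B_def sum_distrib_left by (rule sum.cong) (simp_all add: mult_ac)
  finally show ?thesis .
qed

text \<open>The eigenvalue of \<open>v i\<close> has to be \<open>e i + c\<close> because \<open>M\<close> has multiplier \<open>c\<close> and \<open>u i\<close>, \<open>v i\<close>
  are not orthogonal. The normalisation \<open>e i = 0\<close> for \<open>c = 1\<close> orders each pair by parity.\<close>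
definition darboux :: "'a mat \<Rightarrow> 'a \<Rightarrow> nat \<Rightarrow> (nat \<Rightarrow> nat \<Rightarrow> 'a) \<Rightarrow> (nat \<Rightarrow> nat \<Rightarrow> 'a) \<Rightarrow> (nat \<Rightarrow> 'a) \<Rightarrow> bool" where
  "darboux M c m u v e \<longleftrightarrow> (\<forall>i<m. (\<forall>r<N. mv M (u i) r = e i * u i r) \<and>
      (\<forall>r<N. mv M (v i) r = (e i + c) * v i r) \<and> e i \<in> {0, 1} \<and> (c = 1 \<longrightarrow> e i = 0) \<and>
      (\<forall>j<m. B (u i) (u j) = 0 \<and> B (v i) (v j) = 0 \<and> B (u i) (v j) = of_bool (i = j)))"

text \<open>These are fewer than \<open>N\<close> linear equations in \<open>N\<close> unknowns,
  padded with zero rows to a square matrix so that a vanishing determinant yields the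
  solution.\<close>

lemma exists_orthogonal:
  assumes "2 * m < N"
  shows "\<exists>x. (\<exists>i<N. x i \<noteq> 0) \<and> (\<forall>i<m. B x (u i) = 0 \<and> B x (v i) = 0)"
proof -
  define A :: "'a mat" where "A = mat N N (\<lambda>(r, s).
    if r < m then u r (\<sigma> s) else if r < 2 * m then v (r - m) (\<sigma> s) else 0)"
  have A: "A \<in> CM" by (simp add: A_def)
  \<comment> \<open>The last row is among the padded ones, since \<open>2 * m < N\<close>.\<close>
  have "transpose_mat A *\<^sub>v unit_vec N (N - 1) = 0\<^sub>v N"
    using assms A by (intro eq_vecI) (auto simp: A_def)
  moreover have "unit_vec N (N - 1) \<noteq> (0\<^sub>v N :: 'a vec)"
    using assms by simp
  ultimately have "det (transpose_mat A) = 0"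
    using A by (subst det_0_iff_vec_prod_zero_field[of _ N]) (auto intro!: exI[of _ "unit_vec N (N - 1)"])
  then have "det A = 0" using det_transpose[OF A] by simp
  then obtain x where x: "x \<in> carrier_vec N" "x \<noteq> 0\<^sub>v N" "A *\<^sub>v x = 0\<^sub>v N"
    using det_0_iff_vec_prod_zero_field[OF A] by blast
  have "\<exists>i<N. x $ i \<noteq> 0"
  proof (rule ccontr)
    assume "\<not> ?thesis"
    then have "x = 0\<^sub>v N" using x(1) by (intro eq_vecI) auto
    then show False using x(2) by simp
  qed
  moreover have prod: "(\<Sum>s<N. A $$ (r, s) * x $ s) = 0" if r: "r < N" for r
  proof -
    have "(A *\<^sub>v x) $ r = (\<Sum>s<N. A $$ (r, s) * x $ s)"
      using carrier_matD[OF A] carrier_vecD[OF x(1)] r by (simp add: scalar_prod_def atLeast0LessThan)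
    then show ?thesis unfolding x(3) using r by simp
  qed
  moreover have "B (\<lambda>s. x $ s) (u i) = 0" "B (\<lambda>s. x $ s) (v i) = 0" if i: "i < m" for i
    using prod[of i] prod[of "m + i"] assms i
    by (simp_all add: A_def B_def mult.commute)
  ultimately show ?thesis by blast
qed

text \<open>The orthogonal complement of the earlier pairs is stable under \<open>M\<close> and so
  contains an eigenvector \<open>w\<close>. A partner \<open>z\<close> is then made an eigenvector
  and orthogonal to the earlier pairs, in this order.\<close>

lemma darboux_step:
  assumes M: "M \<in> CM" "M * M = M" and adj: "\<And>x y. B (mv M x) y + B x (mv M y) = c * B x y"
    and c: "c \<in> {0, 1}" and dar: "darboux M c m u v e" and m: "2 * m < N"
  shows "\<exists>u v e. darboux M c (Suc m) u v e"
proof -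
  have D: "\<And>i r. i < m \<Longrightarrow> r < N \<Longrightarrow> mv M (u i) r = e i * u i r"
    "\<And>i r. i < m \<Longrightarrow> r < N \<Longrightarrow> mv M (v i) r = (e i + c) * v i r"
    "\<And>i. i < m \<Longrightarrow> e i \<in> {0, 1}" "\<And>i. i < m \<Longrightarrow> c = 1 \<Longrightarrow> e i = 0"
    "\<And>i j. i < m \<Longrightarrow> j < m \<Longrightarrow> B (u i) (u j) = 0"
    "\<And>i j. i < m \<Longrightarrow> j < m \<Longrightarrow> B (v i) (v j) = 0"
    "\<And>i j. i < m \<Longrightarrow> j < m \<Longrightarrow> B (u i) (v j) = of_bool (i = j)"
    using dar by (simp_all add: darboux_def)
  have mvmv: "mv M (mv M x) r = mv M x r" if "r < N" for x r
    using mv_mult[OF M(1,1) that] M(2) by simp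
  \<comment> \<open>Eigenvectors that are not orthogonal have eigenvalues with sum
    \<open>c\<close>.\<close>
  have eig: "(\<alpha> + \<beta>) * B x y = c * B x y"
    if "\<And>r. r < N \<Longrightarrow> mv M x r = \<alpha> * x r" "\<And>r. r < N \<Longrightarrow> mv M y r = \<beta> * y r" for x y \<alpha> \<beta>
  proof -
    have "B (mv M x) y = \<alpha> * B x y"
      unfolding B_smult(1)[symmetric] by (rule B_cong) (simp_all add: that)
    moreover have "B x (mv M y) = \<beta> * B x y"
      unfolding B_smult(2)[symmetric] by (rule B_cong) (simp_all add: that)
    ultimately show ?thesis using adj[of x y] by (simp add: distrib_right)
  qed
  obtain x where x: "\<exists>i<N. x i \<noteq> 0" "\<And>i. i < m \<Longrightarrow> B x (u i) = 0" "\<And>i. i < m \<Longrightarrow> B x (v i) = 0"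
    using exists_orthogonal[OF m, of u v] by blast
  have Mx: "B (mv M x) (u i) = 0" "B (mv M x) (v i) = 0" if i: "i < m" for i
  proof -
    have "B x (mv M (u i)) = e i * B x (u i)" "B x (mv M (v i)) = (e i + c) * B x (v i)"
      unfolding B_smult(2)[symmetric] by (rule B_cong; simp add: D i)+
    then show "B (mv M x) (u i) = 0" "B (mv M x) (v i) = 0"
      using adj[of x "u i"] adj[of x "v i"] x(2,3)[OF i] by simp_all
  qed
  \<comment> \<open>For idempotent \<open>M\<close>, the image of \<open>x\<close> is an eigenvector
    for 1 unless it is zero, and then \<open>x\<close> itself is one for 0.\<close>
  obtain w \<epsilon> where w: "\<exists>i<N. w i \<noteq> 0" "\<And>i. i < m \<Longrightarrow> B w (u i) = 0" "\<And>i. i < m \<Longrightarrow> B w (v i) = 0"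
    and w\<epsilon>: "\<And>r. r < N \<Longrightarrow> mv M w r = \<epsilon> * w r" "\<epsilon> \<in> {0, 1}"
  proof (cases "\<exists>i<N. mv M x i \<noteq> 0")
    case True
    then show ?thesis using that[of "mv M x" 1] Mx mvmv by simp
  next
    case False
    then show ?thesis using that[of x 0] x by simp
  qed
  obtain i0 where i0: "i0 < N" "w i0 \<noteq> 0" using w(1) by blast
  \<comment> \<open>A multiple of a unit vector, placed opposite a nonzero coordinate of
    \<open>w\<close> and scaled to give \<open>B w y = 1\<close>.\<close>
  define y where "y = (\<lambda>s. of_bool (s = \<sigma> i0) / w i0)"
  have "B w y = (\<Sum>i<N. if i = i0 then 1 else 0)"
    unfolding B_def y_def using i0 by (intro sum.cong) auto
  then have Bwy: "B w y = 1" using i0 by simp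
  have BwMy: "B w (mv M y) = \<epsilon> + c"
  proof -
    have "B (mv M w) y = \<epsilon> * B w y"
      unfolding B_smult(1)[symmetric] by (rule B_cong) (simp_all add: w\<epsilon>)
    then show ?thesis using adj[of w y] Bwy by (metis add.commute add.left_commute mult.right_neutral two_zero_left)
  qed
  have \<epsilon>c: "\<epsilon> + c \<in> {0, 1}" using w\<epsilon>(2) c by (auto simp: two_zero)
  \<comment> \<open>Project \<open>y\<close> to the eigenspace of \<open>\<epsilon> + c\<close>. The
    discarded component is orthogonal to \<open>w\<close>, so the pairing remains 1.\<close>
  obtain z0 where z0: "B w z0 = 1" "\<And>r. r < N \<Longrightarrow> mv M z0 r = (\<epsilon> + c) * z0 r"
  proof (cases "\<epsilon> + c = 0")
    case True
    show ?thesis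
    proof (rule that[of "\<lambda>s. y s + mv M y s"])
      show "B w (\<lambda>s. y s + mv M y s) = 1" using BwMy Bwy True by (simp add: B_add)
      show "mv M (\<lambda>s. y s + mv M y s) r = (\<epsilon> + c) * (y r + mv M y r)" if "r < N" for r
        using mvmv[OF that] True by (simp add: mv_add)
    qed
  next
    case False
    then have "\<epsilon> + c = 1" using \<epsilon>c by simp
    then show ?thesis using that[of "mv M y"] BwMy mvmv by simp
  qed
  \<comment> \<open>Subtract the components along the earlier pairs. The coefficient of
    \<open>u i\<close> is the pairing with \<open>v i\<close> and conversely, because these vectors
    are dual to each other.\<close>
  define z where "z = (\<lambda>s. z0 s + (\<Sum>i<m. B z0 (v i) * u i s + B z0 (u i) * v i s))"
  have Bz: "B z y = B z0 y + (\<Sum>i<m. B z0 (v i) * B (u i) y + B z0 (u i) * B (v i) y)" for y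
    unfolding z_def by (rule B_lincomb)
  have zu: "B z (u j) = 0" if j: "j < m" for j
  proof -
    have "(\<Sum>i<m. B z0 (v i) * B (u i) (u j) + B z0 (u i) * B (v i) (u j)) = (\<Sum>i<m. if i = j then B z0 (u i) else 0)"
      by (rule sum.cong) (use D(5)[OF _ j] D(7)[OF j] B_sym[of _ "u j"] in auto)
    then show ?thesis using j by (simp add: Bz)
  qed
  have zv: "B z (v j) = 0" if j: "j < m" for j
  proof -
    have "(\<Sum>i<m. B z0 (v i) * B (u i) (v j) + B z0 (u i) * B (v i) (v j)) = (\<Sum>i<m. if i = j then B z0 (v i) else 0)"
      by (rule sum.cong) (use D(6)[OF _ j] D(7)[OF _ j] in auto)
    then show ?thesis using j by (simp add: Bz)
  qed
  have zw: "B z w = 1"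
  proof -
    have "(\<Sum>i<m. B z0 (v i) * B (u i) w + B z0 (u i) * B (v i) w) = 0"
      by (rule sum.neutral) (use w(2,3) B_sym[of _ w] in auto)
    then show ?thesis using z0(1) B_sym[of z0 w] by (simp add: Bz)
  qed
  have zM: "mv M z r = (\<epsilon> + c) * z r" if r: "r < N" for r
  proof -
    have "B z0 (v i) * mv M (u i) r + B z0 (u i) * mv M (v i) r = (\<epsilon> + c) * (B z0 (v i) * u i r + B z0 (u i) * v i r)"
      if i: "i < m" for i
    proof -
      \<comment> \<open>The correction stays in the eigenspace: by \<open>eig\<close>, a nonzero
        coefficient occurs only with a vector of eigenvalue \<open>\<epsilon> + c\<close>.\<close>
      have "B z0 (v i) * e i = B z0 (v i) * (\<epsilon> + c)"
      proof (cases "B z0 (v i) = 0")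
        case False
        then have "(\<epsilon> + c) + (e i + c) = c" using eig[OF z0(2) D(2)[OF i]] by simp
        then have "e i = \<epsilon> + c" by (metis add.assoc add.commute two_zero_left)
        then show ?thesis by simp
      qed simp
      moreover have "B z0 (u i) * (e i + c) = B z0 (u i) * (\<epsilon> + c)"
      proof (cases "B z0 (u i) = 0")
        case False
        then have "(\<epsilon> + c) + e i = c" using eig[OF z0(2) D(1)[OF i]] by simp
        then have "e i + c = \<epsilon> + c" by (metis add.assoc add.commute two_zero_left)
        then show ?thesis by simp
      qed simp
      ultimately have "(B z0 (v i) * e i) * u i r = (B z0 (v i) * (\<epsilon> + c)) * u i r"
        "(B z0 (u i) * (e i + c)) * v i r = (B z0 (u i) * (\<epsilon> + c)) * v i r"
        by simp_all
      then have "B z0 (v i) * (e i * u i r) = (\<epsilon> + c) * (B z0 (v i) * u i r)"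
        "B z0 (u i) * ((e i + c) * v i r) = (\<epsilon> + c) * (B z0 (u i) * v i r)"
        by (simp_all only: mult_ac)
      then show ?thesis unfolding D(1)[OF i r] D(2)[OF i r] distrib_left[of "\<epsilon> + c"] by (simp only:)
    qed
    then show ?thesis
      unfolding z_def mv_lincomb using z0(2)[OF r] by (simp add: distrib_left sum_distrib_left)
  qed
  have ext: "darboux M c (Suc m) (u(m := a)) (v(m := b)) (e(m := d))"
    if a: "\<And>r. r < N \<Longrightarrow> mv M a r = d * a r" "\<And>r. r < N \<Longrightarrow> mv M b r = (d + c) * b r"
      and d: "d \<in> {0, 1}" "c = 1 \<Longrightarrow> d = 0" and ab: "B a b = 1"
      and o: "\<And>i. i < m \<Longrightarrow> B a (u i) = 0" "\<And>i. i < m \<Longrightarrow> B a (v i) = 0"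
        "\<And>i. i < m \<Longrightarrow> B b (u i) = 0" "\<And>i. i < m \<Longrightarrow> B b (v i) = 0" for a b d
  proof -
    have o': "B (u i) a = 0" "B (v i) a = 0" "B (u i) b = 0" "B (v i) b = 0" if "i < m" for i
      using o[OF that] B_sym[of a] B_sym[of b] by simp_all
    show ?thesis
      unfolding darboux_def less_Suc_eq using D a d ab o o'
      by (auto simp: B_alternating)
  qed
  show ?thesis
  \<comment> \<open>Here \<open>w\<close> has eigenvalue 1 and \<open>z\<close> has eigenvalue 0, so
    they trade places to satisfy the normalisation in \<open>darboux\<close>.\<close>
  proof (cases "c = 1 \<and> \<epsilon> = 1")
    case True
    have "darboux M c (Suc m) (u(m := z)) (v(m := w)) (e(m := 0))"
      by (rule ext) (use True zM w\<epsilon> zw zu zv w in simp_all)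
    then show ?thesis by blast
  next
    case False
    have "darboux M c (Suc m) (u(m := w)) (v(m := z)) (e(m := \<epsilon>))"
      by (rule ext) (use False zM w\<epsilon> zw zu zv w B_sym[of w z] in auto)
    then show ?thesis by blast
  qed
qed

lemma darboux_exists:
  assumes M: "M \<in> CM" "M * M = M" and adj: "transpose_mat M * G + G * M = c \<cdot>\<^sub>m G"
    and c: "c \<in> {0, 1}" and m: "2 * m \<le> N"
  shows "\<exists>u v e. darboux M c m u v e"
  using m
proof (induction m)
  case 0
  show ?case by (simp add: darboux_def)
next
  case (Suc m)
  then obtain u v e where "darboux M c m u v e" by auto
  then show ?case
    using darboux_step[OF M B_adjoint[OF M(1) adj] c] Suc.prems by simp
qed

text \<open>Applying the multiplier equation to (Mx, y) and to (x, My) expresses B(Mx, My) as (c +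
  1) B(Mx, y) and as (c + 1) B(x, My). Adding them gives (c + 1) c B(x, y) = 0, and a dual pair of
  unit vectors has B(x, y) = 1.\<close>

lemma idempotent_multiplier:
  assumes M: "M \<in> CM" "M * M = M" and adj: "transpose_mat M * G + G * M = c \<cdot>\<^sub>m G"
  shows "c \<in> {0, 1}"
proof -
  note a = B_adjoint[OF M(1) adj]
  have mvmv: "mv M (mv M x) r = mv M x r" if "r < N" for x r
    using mv_mult[OF M(1,1) that] M(2) by simp
  have i2: "B (mv M (mv M x)) y = B (mv M x) y" "B y (mv M (mv M x)) = B y (mv M x)" for x y
    by (rule B_cong; simp add: mvmv)+
  define x where "x = (\<lambda>s. of_bool (s = (0::nat)) :: 'a)"
  define y where "y = (\<lambda>s. of_bool (s = \<sigma> 0) :: 'a)"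
  have "B x y = (\<Sum>i<N. if i = 0 then 1 else 0)"
    unfolding B_def x_def y_def using N_ge by (intro sum.cong) auto
  then have xy: "B x y = 1" using N_ge by simp
  have 1: "B (mv M x) y + B x (mv M y) = c" using a[of x y] xy by simp
  have 2: "B (mv M x) (mv M y) = c * B (mv M x) y + B (mv M x) y"
    using a[of "mv M x" y] i2 by (metis add.commute two_zero_left)
  have 3: "B (mv M x) (mv M y) = c * B x (mv M y) + B x (mv M y)"
    using a[of x "mv M y"] i2 by (metis add.commute two_zero_left)
  have "(c + 1) * (B (mv M x) y + B x (mv M y)) = (c * B (mv M x) y + B (mv M x) y) + (c * B x (mv M y) + B x (mv M y))"
    by (simp add: algebra_simps)
  then have "(c + 1) * (B (mv M x) y + B x (mv M y)) = 0"
    by (simp only: 2[symmetric] 3[symmetric] two_zero)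
  then have "(c + 1) * c = 0" using 1 by simp
  then have "c = 0 \<or> c + 1 = 0" by auto
  then show ?thesis by (metis insert_iff two_zero_left add.right_neutral add.commute)
qed

text \<open>Column \<open>i\<close> is taken from pair \<open>p i\<close>, with \<open>t i\<close>
  choosing its second member. Leaving the arrangement free lets one lemma serve both
  \<open>oo\<close> and \<open>pe\<close>; the condition on \<open>\<tau>\<close> says that it
  matches the two columns of each pair.\<close>

lemma darboux_matrix:
  assumes M: "M \<in> CM" and dar: "darboux M c n u v e"
    and p: "\<And>i. i < N \<Longrightarrow> p i < n"
    and \<tau>: "\<And>i j. i < N \<Longrightarrow> j < N \<Longrightarrow> (p i = p j \<and> t i \<noteq> t j) \<longleftrightarrow> j = \<tau> i"
  defines "P \<equiv> mat N N (\<lambda>(r, i). if t i then v (p i) r else u (p i) r)"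
  shows "transpose_mat P * G * P = inv_mat N \<tau>"
    "M * P = P * mat N N (\<lambda>(i, j). if i = j then (if t i then e (p i) + c else e (p i)) else 0)"
proof -
  define w where "w i = (if t i then v (p i) else u (p i))" for i
  have P: "P \<in> CM" "transpose_mat P \<in> CM" by (simp_all add: P_def)
  have Pent: "P $$ (r, i) = w i r" if "r < N" "i < N" for r i
    using that by (simp add: P_def w_def)
  show "transpose_mat P * G * P = inv_mat N \<tau>"
  proof (rule eq_matI)
    fix i j assume "i < dim_row (inv_mat N \<tau>)" "j < dim_col (inv_mat N \<tau>)"
    then have ij: "i < N" "j < N" by (simp_all add: inv_mat_def)
    have "(transpose_mat P * G * P) $$ (i, j) = (\<Sum>k<N. (transpose_mat P * G) $$ (i, k) * P $$ (k, j))"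
      using P ij by (simp add: mult_entry)
    also have "\<dots> = (\<Sum>k<N. w i (\<sigma> k) * w j (\<sigma> (\<sigma> k)))"
      by (rule sum.cong) (use P ij in \<open>simp_all add: mult_G_entry transpose_entry Pent\<close>)
    also have "\<dots> = B (w i) (w j)"
      unfolding B_def by (rule sum_\<sigma>[of "\<lambda>k. w i k * w j (\<sigma> k)"])
    also have "\<dots> = of_bool (p i = p j \<and> t i \<noteq> t j)"
      using dar p[OF ij(1)] p[OF ij(2)] B_sym[of "v (p i)" "u (p j)"] by (auto simp: w_def darboux_def)
    also have "\<dots> = inv_mat N \<tau> $$ (i, j)" using ij by (simp only: \<tau>[OF ij] inv_mat_def index_mat prod.case of_bool_def)
    finally show "(transpose_mat P * G * P) $$ (i, j) = inv_mat N \<tau> $$ (i, j)" .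
  qed (use P in \<open>simp_all add: inv_mat_def\<close>)
  let ?D = "mat N N (\<lambda>(i, j). if i = j then (if t i then e (p i) + c else e (p i)) else 0)"
  have D: "?D \<in> CM" by simp
  show "M * P = P * ?D"
  proof (rule eq_matI)
    fix r i assume "r < dim_row (P * ?D)" "i < dim_col (P * ?D)"
    then have ri: "r < N" "i < N" using P by simp_all
    have "(M * P) $$ (r, i) = mv M (w i) r"
      using M P ri by (simp add: mult_entry mv_def Pent)
    also have "\<dots> = (if t i then e (p i) + c else e (p i)) * w i r"
      using dar p[OF ri(2)] ri by (simp add: w_def darboux_def)
    also have "\<dots> = (\<Sum>k<N. if k = i then (if t i then e (p i) + c else e (p i)) * w i r else 0)"
      using ri by simp
    also have "\<dots> = (\<Sum>k<N. P $$ (r, k) * ?D $$ (k, i))"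
      by (rule sum.cong) (use ri in \<open>auto simp: Pent\<close>)
    also have "\<dots> = (P * ?D) $$ (r, i)" using P ri by (simp add: mult_entry)
    finally show "(M * P) $$ (r, i) = (P * ?D) $$ (r, i)" .
  qed (use M P in simp_all)
qed

end

section \<open>The isomorphism induced by an adapted basis\<close>

text \<open>The model of a grading: commutation with this idempotent kills block diagonal matrices
  and fixes block off-diagonal ones.\<close>

definition parity_mat :: "nat \<Rightarrow> nat \<Rightarrow> 'a::field mat" where
  "parity_mat N a = mat N N (\<lambda>(i, j). if i = j \<and> a \<le> i then 1 else 0)"

lemma parity_mat_carrier [simp]: "parity_mat N a \<in> carrier_mat N N"
  by (simp add: parity_mat_def)

context involution_form
begin

lemma mcomm_parity_entry:
  assumes "Y \<in> CM" "i < N" "j < N"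
  shows "mcomm (parity_mat N a) Y $$ (i, j) = (if (i < a) = (j < a) then 0 else Y $$ (i, j))"
proof -
  have "(parity_mat N a * Y) $$ (i, j) = (\<Sum>k<N. if k = i then (if a \<le> i then Y $$ (k, j) else 0) else 0)"
    unfolding mult_entry[OF parity_mat_carrier assms]
    by (rule sum.cong) (use assms in \<open>auto simp: parity_mat_def\<close>)
  moreover have "(Y * parity_mat N a) $$ (i, j) = (\<Sum>k<N. if k = j then (if a \<le> j then Y $$ (i, k) else 0) else 0)"
    unfolding mult_entry[OF assms(1) parity_mat_carrier assms(2,3)]
    by (rule sum.cong) (use assms in \<open>auto simp: parity_mat_def\<close>)
  ultimately show ?thesis
    using assms by (auto simp: mcomm_eq add_entry simp del: index_add_mat)
qed

lemma scalar_mats_ev: "Y \<in> scalar_mats N \<Longrightarrow> (Y :: 'a mat) \<in> mat_ev N a"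
  by (auto simp: scalar_mats_def mat_ev_def)

lemma mat_ev_add: "X \<in> mat_ev N a \<Longrightarrow> Y \<in> mat_ev N a \<Longrightarrow> (X::'a mat) \<in> CM \<Longrightarrow> Y \<in> CM \<Longrightarrow> X + Y \<in> mat_ev N a"
  by (auto simp: mat_ev_def)

lemma mat_odd_add: "X \<in> mat_odd N a \<Longrightarrow> Y \<in> mat_odd N a \<Longrightarrow> (X::'a mat) \<in> CM \<Longrightarrow> Y \<in> CM \<Longrightarrow> X + Y \<in> mat_odd N a"
  by (auto simp: mat_odd_def)

lemma mat_ev_odd: "X \<in> mat_ev N a \<Longrightarrow> X \<in> mat_odd N a \<Longrightarrow> X \<in> CM \<Longrightarrow> X = (0\<^sub>m N N :: 'a mat)"
  by (rule eq_matI) (auto simp: mat_ev_def mat_odd_def)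

lemma mat_lie_L2: "mat_ops N h \<Longrightarrow> lcar h = L2 \<Longrightarrow> mat_lie N h"
  by unfold_locales (simp_all add: L2_subspace L2_mcomm)

lemma center_L2: "mat_ops N h \<Longrightarrow> lcar h = L2 \<Longrightarrow> center h = L2 \<inter> scalar_mats N"
  unfolding Z2_eq[symmetric] by (simp add: center_def Z2_def mat_ops_def)

end

text \<open>The source \<open>h\<close> belongs to the form of \<open>\<sigma>\<close>, the target
  \<open>h'\<close> to that of \<open>\<tau>\<close>. One matrix \<open>P\<close> both carries the
  first form to the second and brings \<open>M\<close> to \<open>parity_mat\<close>, while
  \<open>M_g0\<close> and \<open>M_g1\<close> say that \<open>M\<close> induces the grading modulo
  the center.\<close>

locale graded_form = char2_mat N ty + B: involution_form N ty \<sigma> + T: involution_form N ty \<tau>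
    + H: mat_lie N ty h + H': mat_lie N ty h'
  for N :: nat and ty :: "'a::field itself" and \<sigma> \<tau> h h' +
  fixes a :: nat and P Q M :: "'a mat" and g0 g1 :: "'a mat set set"
  assumes h_car: "lcar h = B.L2" and h'_car: "lcar h' = T.L2"
    and h'_ev: "lev h' = T.L2 \<inter> mat_ev N a" and h'_odd: "lodd h' = T.L2 \<inter> mat_odd N a"
    and P: "P \<in> CM" and Q: "Q \<in> CM" and PQ: "P * Q = 1\<^sub>m N" and QP: "Q * P = 1\<^sub>m N"
    and PGP: "transpose_mat P * B.G * P = T.G"
    and M: "M \<in> CM" and MP: "M * P = P * parity_mat N a"
    and grading: "Z2_grading H.q g0 g1"
    and M_g0: "X \<in> B.L2 \<Longrightarrow> H.K X \<in> g0 \<Longrightarrow> mcomm M X \<in> center h"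
    and M_g1: "X \<in> B.L2 \<Longrightarrow> H.K X \<in> g1 \<Longrightarrow> mcomm M X + X \<in> center h"
begin

section \<open>Conjugation between the two Lie algebras\<close>

definition \<Phi> where "\<Phi> X = Q * X * P"
definition \<Psi> where "\<Psi> Y = P * Y * Q"

lemma \<Phi>_CM [simp]: "X \<in> CM \<Longrightarrow> \<Phi> X \<in> CM"
  using P Q by (simp add: \<Phi>_def)

lemma \<Psi>_CM [simp]: "X \<in> CM \<Longrightarrow> \<Psi> X \<in> CM"
  using P Q by (simp add: \<Psi>_def)

lemma \<Psi>_\<Phi> [simp]: "X \<in> CM \<Longrightarrow> \<Psi> (\<Phi> X) = X"
  unfolding \<Phi>_def \<Psi>_def by (rule conj_inv[OF P Q PQ])

lemma \<Phi>_\<Psi> [simp]: "X \<in> CM \<Longrightarrow> \<Phi> (\<Psi> X) = X"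
  unfolding \<Phi>_def \<Psi>_def by (rule conj_inv[OF Q P QP])

lemma \<Phi>_add: "X \<in> CM \<Longrightarrow> Y \<in> CM \<Longrightarrow> \<Phi> (X + Y) = \<Phi> X + \<Phi> Y"
  using P Q by (simp add: \<Phi>_def mat_distrib)

lemma \<Phi>_smult: "X \<in> CM \<Longrightarrow> \<Phi> (c \<cdot>\<^sub>m X) = c \<cdot>\<^sub>m \<Phi> X"
  using P Q by (simp add: \<Phi>_def mat_smult)

lemma \<Phi>_mcomm: "X \<in> CM \<Longrightarrow> Y \<in> CM \<Longrightarrow> \<Phi> (mcomm X Y) = mcomm (\<Phi> X) (\<Phi> Y)"
  unfolding \<Phi>_def by (rule conj_mcomm[OF P Q PQ])

lemma \<Phi>_mult: "X \<in> CM \<Longrightarrow> Y \<in> CM \<Longrightarrow> \<Phi> (X * Y) = \<Phi> X * \<Phi> Y"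
  unfolding \<Phi>_def by (rule conj_mult[OF P Q PQ])

lemma \<Psi>_zero: "\<Psi> (0\<^sub>m N N) = 0\<^sub>m N N"
  using P Q by (simp add: \<Psi>_def)

lemma QGQ: "transpose_mat Q * T.G * Q = B.G"
proof -
  have T: "transpose_mat P \<in> CM" "transpose_mat Q \<in> CM" using P Q by simp_all
  have TQ: "transpose_mat Q * transpose_mat P = 1\<^sub>m N"
    using transpose_mult[OF P Q] PQ by simp
  have "transpose_mat Q * T.G * Q = (transpose_mat Q * transpose_mat P) * B.G * (P * Q)"
    unfolding PGP[symmetric] using P Q T by (simp add: mat_mult_assoc)
  then show ?thesis by (simp add: TQ PQ left_mult_one_mat[of _ N N] right_mult_one_mat[of _ N N])
qed

lemma \<Phi>_L2 [simp]: "X \<in> B.L2 \<Longrightarrow> \<Phi> X \<in> T.L2"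
  unfolding \<Phi>_def
  by (rule conj_mat_derived[OF P Q PQ B.L1_CM], rule conj_mat_derived[OF P Q PQ B.L0_CM],
      rule conj_form_lie[OF P Q PQ PGP]) simp_all

lemma \<Psi>_L2 [simp]: "X \<in> T.L2 \<Longrightarrow> \<Psi> X \<in> B.L2"
  unfolding \<Psi>_def
  by (rule conj_mat_derived[OF Q P QP T.L1_CM], rule conj_mat_derived[OF Q P QP T.L0_CM],
      rule conj_form_lie[OF Q P QP QGQ]) simp_all

lemma L2_CM' [simp]: "X \<in> B.L2 \<Longrightarrow> X \<in> CM" "X \<in> T.L2 \<Longrightarrow> X \<in> CM"
  using B.L2_CM T.L2_CM by blast+

lemma Z_eq: "center h = B.L2 \<inter> scalar_mats N" and Z'_eq: "center h' = T.L2 \<inter> scalar_mats N"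
  using B.center_L2[OF H.ops h_car] T.center_L2[OF H'.ops h'_car] .

lemma \<Phi>_scalar: "X \<in> scalar_mats N \<Longrightarrow> \<Phi> X = X" "X \<in> scalar_mats N \<Longrightarrow> \<Psi> X = X"
  using P Q by (auto simp: scalar_mats_def \<Phi>_def \<Psi>_def mat_smult PQ QP)

lemma \<Phi>_Z: "X \<in> center h \<Longrightarrow> \<Phi> X \<in> center h'"
  unfolding Z_eq Z'_eq using \<Phi>_L2[of X] \<Phi>_scalar(1)[of X] by simp

lemma \<Psi>_Z: "X \<in> center h' \<Longrightarrow> \<Psi> X \<in> center h"
  unfolding Z_eq Z'_eq using \<Psi>_L2[of X] \<Phi>_scalar(2)[of X] by simp

lemma \<Phi>_Z_iff: "X \<in> CM \<Longrightarrow> \<Phi> X \<in> center h' \<longleftrightarrow> X \<in> center h"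
  using \<Phi>_Z \<Psi>_Z[of "\<Phi> X"] by auto

lemma \<Phi>_M: "\<Phi> M = parity_mat N a"
proof -
  have "\<Phi> M = Q * (P * parity_mat N a)"
    unfolding \<Phi>_def MP[symmetric] using P Q M by (simp add: mat_mult_assoc)
  also have "\<dots> = (Q * P) * parity_mat N a"
    using P Q by (simp only: mat_mult_assoc parity_mat_carrier)
  finally show ?thesis by (simp add: QP left_mult_one_mat[of _ N N])
qed

section \<open>Parity of representatives\<close>

lemma Z'_ev: "Y \<in> center h' \<Longrightarrow> Y \<in> mat_ev N a"
  unfolding Z'_eq using B.scalar_mats_ev by blast

text \<open>A commutator with \<open>parity_mat\<close> is block off-diagonal, whereas central
  elements are scalar and thus block diagonal. So the off-diagonal blocks vanish for every
  representative of a class in \<open>g0\<close>.\<close>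

lemma g0_even:
  assumes X: "X \<in> B.L2" "H.K X \<in> g0"
  shows "\<Phi> X \<in> mat_ev N a"
proof -
  have "\<Phi> (mcomm M X) \<in> mat_ev N a" using M_g0[OF X] \<Phi>_Z Z'_ev by blast
  then have "mcomm (parity_mat N a) (\<Phi> X) \<in> mat_ev N a" using X M by (simp add: \<Phi>_mcomm \<Phi>_M)
  then show ?thesis using X B.mcomm_parity_entry[of "\<Phi> X" _ _ a] by (simp add: mat_ev_def)
qed

text \<open>A class in \<open>g1\<close> may have representatives with a central even part, so only
  some representative is odd. The matrix \<open>C\<close> is exactly the even part of
  \<open>\<Phi> X\<close>, and it is central.\<close>

lemma g1_odd:
  assumes X: "X \<in> B.L2" "H.K X \<in> g1"
  shows "\<exists>X'\<in>B.L2. H.K X' = H.K X \<and> \<Phi> X' \<in> mat_odd N a"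
proof -
  define C where "C = \<Phi> (mcomm M X + X)"
  have CZ: "C \<in> center h'" unfolding C_def using M_g1[OF X] by (rule \<Phi>_Z)
  have C: "C = mcomm (parity_mat N a) (\<Phi> X) + \<Phi> X"
    unfolding C_def using X M by (simp add: \<Phi>_add \<Phi>_mcomm \<Phi>_M)
  define X' where "X' = X + \<Psi> C"
  have PC: "\<Psi> C \<in> center h" using CZ by (rule \<Psi>_Z)
  then have PC': "\<Psi> C \<in> B.L2" unfolding Z_eq by blast
  have X': "X' \<in> B.L2" unfolding X'_def using X(1) PC' by (rule mat_derived_add)
  have CL: "C \<in> CM" using CZ by simp
  have "\<Phi> X' = \<Phi> X + C" unfolding X'_def using X CL by (simp add: \<Phi>_add)
  then have "\<Phi> X' = mcomm (parity_mat N a) (\<Phi> X)" using X C by (simp add: mat_ac)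
  then have "\<Phi> X' \<in> mat_odd N a" using X B.mcomm_parity_entry[of "\<Phi> X" _ _ a] by (simp add: mat_odd_def)
  moreover have "H.K X' = H.K X"
    using X X' PC CL by (subst H.K_eq_iff) (simp_all add: X'_def mat_ac)
  ultimately show ?thesis using X' by blast
qed

lemma gr:
  "g0 \<subseteq> H.K ` B.L2" "g1 \<subseteq> H.K ` B.L2"
  "x \<in> H.K ` B.L2 \<Longrightarrow> \<exists>x0\<in>g0. \<exists>x1\<in>g1. x = ladd H.q x0 x1"
proof -
  have "g0 \<subseteq> lcar H.q" "g1 \<subseteq> lcar H.q" and *: "\<forall>x\<in>lcar H.q. \<exists>x0\<in>g0. \<exists>x1\<in>g1. x = ladd H.q x0 x1"
    using grading by (simp_all add: Z2_grading_def subspace_of_def)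
  then show "g0 \<subseteq> H.K ` B.L2" "g1 \<subseteq> H.K ` B.L2" by (simp_all only: H.q_car h_car)
  show "\<exists>x0\<in>g0. \<exists>x1\<in>g1. x = ladd H.q x0 x1" if "x \<in> H.K ` B.L2"
    using bspec[OF *, unfolded H.q_car h_car, OF that] .
qed

lemma decompose:
  assumes X: "X \<in> B.L2"
  obtains X0 X1 where "X0 \<in> B.L2" "X1 \<in> B.L2" "H.K X0 \<in> g0" "H.K X1 \<in> g1"
    "\<Phi> X0 \<in> mat_ev N a" "\<Phi> X1 \<in> mat_odd N a" "X = X0 + X1"
proof -
  obtain x0 x1 where x: "x0 \<in> g0" "x1 \<in> g1" "H.K X = ladd H.q x0 x1" using gr(3) X by blast
  obtain X0 where X0: "X0 \<in> B.L2" "x0 = H.K X0" using x gr by blast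
  obtain X1' where X1': "X1' \<in> B.L2" "x1 = H.K X1'" using x gr by blast
  obtain X1 where X1: "X1 \<in> B.L2" "H.K X1 = H.K X1'" "\<Phi> X1 \<in> mat_odd N a" using g1_odd X1' x by blast
  have "H.K X = H.K (X0 + X1)"
    using x(3) X0 X1' X1 H.q_add[of X0 X1] by (simp add: h_car)
  then have z: "X + (X0 + X1) \<in> center h" using X X0 X1 by (simp add: H.K_eq_iff)
  \<comment> \<open>The central error of lifting is absorbed by the even component, because scalars
    are even.\<close>
  define X0' where "X0' = X0 + (X + (X0 + X1))"
  have X0'L: "X0' \<in> B.L2"
    unfolding X0'_def using X0 z[THEN H.Z_car] by (simp add: h_car mat_derived_add)
  have "H.K X0' = H.K X0"
    using X0 X0'L z X X1 by (subst H.K_eq_iff) (simp_all add: X0'_def mat_ac)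
  moreover have "X = X0' + X1" unfolding X0'_def using X X0 X1 by (simp add: mat_ac)
  ultimately show thesis using that[of X0' X1] X0'L X1 x X0 X1' g0_even by metis
qed

text \<open>In the decomposition of \<open>X\<close> the odd component is a sum of even matrices,
  hence zero.\<close>

lemma even_g0:
  assumes X: "X \<in> B.L2" "\<Phi> X \<in> mat_ev N a"
  shows "H.K X \<in> g0"
proof -
  obtain X0 X1 where *: "X0 \<in> B.L2" "X1 \<in> B.L2" "H.K X0 \<in> g0" "\<Phi> X0 \<in> mat_ev N a"
    "\<Phi> X1 \<in> mat_odd N a" "X = X0 + X1" using decompose[OF X(1)] by metis
  have "\<Phi> X1 = \<Phi> X + \<Phi> X0" using * by (simp add: \<Phi>_add mat_ac)
  then have "\<Phi> X1 \<in> mat_ev N a" using X * B.mat_ev_add by simp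
  then have "\<Phi> X1 = 0\<^sub>m N N" using * B.mat_ev_odd by simp
  then have "\<Psi> (\<Phi> X1) = \<Psi> (0\<^sub>m N N)" by simp
  then have "X1 = 0\<^sub>m N N" using * \<Psi>_zero by simp
  then show ?thesis using * by simp
qed

lemma odd_g1:
  assumes X: "X \<in> B.L2" "\<Phi> X \<in> mat_odd N a"
  shows "H.K X \<in> g1"
proof -
  obtain X0 X1 where *: "X0 \<in> B.L2" "X1 \<in> B.L2" "H.K X1 \<in> g1" "\<Phi> X0 \<in> mat_ev N a"
    "\<Phi> X1 \<in> mat_odd N a" "X = X0 + X1" using decompose[OF X(1)] by metis
  have "\<Phi> X0 = \<Phi> X + \<Phi> X1" using * by (simp add: \<Phi>_add mat_ac)
  then have "\<Phi> X0 \<in> mat_odd N a" using X * B.mat_odd_add by simp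
  then have "\<Phi> X0 = 0\<^sub>m N N" using * B.mat_ev_odd by simp
  then have "\<Psi> (\<Phi> X0) = \<Psi> (0\<^sub>m N N)" by simp
  then have "X0 = 0\<^sub>m N N" using * \<Psi>_zero by simp
  then show ?thesis using * by simp
qed

lemma odd_square: "X \<in> B.L2 \<Longrightarrow> \<Phi> X \<in> mat_odd N a \<Longrightarrow> X * X \<in> B.L2"
proof -
  assume X: "X \<in> B.L2" "\<Phi> X \<in> mat_odd N a"
  have "\<Phi> (X * X) \<in> T.L2" using T.odd_square[of "\<Phi> X"] X by (simp add: \<Phi>_mult)
  then have "\<Psi> (\<Phi> (X * X)) \<in> B.L2" by (rule \<Psi>_L2)
  then show ?thesis using X by simp
qed

section \<open>Inner derivations and the superalgebra they form\<close>

definition A where "A X = ad H.q (H.K X)"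

lemma A_apply: "X \<in> B.L2 \<Longrightarrow> Y \<in> B.L2 \<Longrightarrow> A X (H.K Y) = H.K (mcomm X Y)"
  using H.q_br[of X Y] by (simp add: A_def ad_def H.q_car h_car)

lemma A_outside: "y \<notin> H.K ` B.L2 \<Longrightarrow> A X y = lzero H.q"
  by (simp add: A_def ad_def H.q_car h_car)

lemma A_eqI:
  assumes "\<And>Y. Y \<in> B.L2 \<Longrightarrow> D (H.K Y) = H.K (mcomm X Y)" "\<And>y. y \<notin> H.K ` B.L2 \<Longrightarrow> D y = lzero H.q"
    and "X \<in> B.L2"
  shows "D = A X"
proof
  fix y
  show "D y = A X y"
    using assms A_apply[OF assms(3)] A_outside[of y X] by (cases "y \<in> H.K ` B.L2") auto
qed

lemma zero_L2: "0\<^sub>m N N \<in> B.L2"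
  by (rule mat_derived_zero)

lemma A_zero: "A X (lzero H.q) = lzero H.q" if "X \<in> B.L2" for X
  using A_apply[OF that zero_L2] that by (simp add: H.q_zero)

lemma q_zero_ops: "ladd H.q (lzero H.q) (lzero H.q) = lzero H.q" "lsmul H.q c (lzero H.q) = lzero H.q"
  unfolding H.q_zero by (simp_all add: H.q_add H.q_smul)

lemma fun_add_A: "X \<in> B.L2 \<Longrightarrow> Y \<in> B.L2 \<Longrightarrow> fun_add H.q (A X) (A Y) = A (X + Y)"
  by (rule A_eqI)
    (simp_all add: fun_add_def A_apply A_outside q_zero_ops H.q_add h_car B.L2_mcomm mcomm_add mat_derived_add)

lemma fun_smul_A: "X \<in> B.L2 \<Longrightarrow> fun_smul H.q c (A X) = A (c \<cdot>\<^sub>m X)"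
  by (rule A_eqI)
    (simp_all add: fun_smul_def A_apply A_outside q_zero_ops H.q_smul h_car B.L2_mcomm mcomm_smult mat_derived_smult)

lemma fun_br_A:
  assumes X: "X \<in> B.L2" and Y: "Y \<in> B.L2"
  shows "fun_br H.q (A X) (A Y) = A (mcomm X Y)"
proof (rule A_eqI)
  show "mcomm X Y \<in> B.L2" using X Y by (rule B.L2_mcomm)
  fix W assume W: "W \<in> B.L2"
  have "fun_br H.q (A X) (A Y) (H.K W) = H.K (mcomm X (mcomm Y W) + (-1) \<cdot>\<^sub>m mcomm Y (mcomm X W))"
    using X Y W by (simp add: fun_br_def fun_add_def fun_smul_def A_apply B.L2_mcomm H.q_add H.q_smul
      h_car mat_derived_smult del: uminus_eq)
  also have "(-1) \<cdot>\<^sub>m mcomm Y (mcomm X W) = mcomm Y (mcomm X W)"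
    using X Y W by (intro eq_matI) (simp_all add: uminus_eq)
  also have "mcomm X (mcomm Y W) + mcomm Y (mcomm X W) = mcomm (mcomm X Y) W"
    using X Y W by (subst mcomm_jacobi[of X Y W]) (simp_all add: mat_ac)
  finally show "fun_br H.q (A X) (A Y) (H.K W) = H.K (mcomm (mcomm X Y) W)" .
next
  fix y assume "y \<notin> H.K ` B.L2"
  then show "fun_br H.q (A X) (A Y) y = lzero H.q"
    using X Y by (simp add: fun_br_def fun_add_def fun_smul_def A_outside A_zero q_zero_ops)
qed

lemma A_square:
  assumes X: "X \<in> B.L2" "X * X \<in> B.L2"
  shows "A X \<circ> A X = A (X * X)"
  by (rule A_eqI) (use X in \<open>simp_all add: A_apply B.L2_mcomm A_outside A_zero mcomm_twice\<close>)

text \<open>The adjoint map is injective on the quotient: an element acting as zero commutes with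
  \<open>L2\<close> modulo the center and is therefore central by
  \<open>mcomm_center_scalar\<close>.\<close>

lemma A_eq_iff:
  assumes X: "X \<in> B.L2" and Y: "Y \<in> B.L2"
  shows "A X = A Y \<longleftrightarrow> X + Y \<in> center h"
proof
  assume "X + Y \<in> center h"
  then have "H.K X = H.K Y" using X Y by (simp add: H.K_eq_iff)
  then show "A X = A Y" by (simp add: A_def)
next
  assume eq: "A X = A Y"
  have "X + Y \<in> scalar_mats N"
  proof (rule B.mcomm_center_scalar)
    fix W assume W: "W \<in> B.L2"
    have "H.K (mcomm X W) = H.K (mcomm Y W)" using eq A_apply X Y W by metis
    then have "mcomm X W + mcomm Y W \<in> center h" using X Y W by (simp add: H.K_eq_iff)
    then show "mcomm (X + Y) W \<in> B.Z2" using X Y W by (simp add: mcomm_add Z_eq B.Z2_eq)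
  qed (use X Y in simp)
  then show "X + Y \<in> center h" using X Y by (simp add: Z_eq mat_derived_add)
qed

lemma g_one_eq: "g_one H.q g1 = A ` B.L2"
proof (intro subset_antisym subsetI)
  fix D assume "D \<in> g_one H.q g1"
  then show "D \<in> A ` B.L2"
  proof induction
    case (g_one_ad x)
    then show ?case by (auto simp: H.q_car h_car A_def)
  next
    case (g_one_sq x)
    then obtain X where X: "X \<in> B.L2" "x = H.K X" using gr by blast
    \<comment> \<open>Only the odd representative has a square controlled by
      \<open>odd_square\<close>.\<close>
    then obtain X' where X': "X' \<in> B.L2" "x = H.K X'" "\<Phi> X' \<in> mat_odd N a" using g1_odd g_one_sq by metis
    then have "ad H.q x \<circ> ad H.q x = A (X' * X')" using A_square[of X'] odd_square by (simp add: A_def)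
    then show ?case using odd_square X' by blast
  next
    case g_one_zero
    have "(\<lambda>y. lzero H.q) = A (0\<^sub>m N N)"
      by (rule A_eqI) (simp_all add: H.q_zero zero_L2)
    then show ?case using zero_L2 by blast
  next
    case (g_one_add D E)
    then show ?case using fun_add_A mat_derived_add by blast
  next
    case (g_one_smul D c)
    then show ?case using fun_smul_A mat_derived_smult by blast
  next
    case (g_one_br D E)
    then show ?case using fun_br_A B.L2_mcomm by blast
  qed
next
  fix D assume "D \<in> A ` B.L2"
  then show "D \<in> g_one H.q g1" by (auto simp: A_def H.q_car h_car intro: g_one_ad)
qed

lemma bracket_grading:
  "x \<in> g0 \<Longrightarrow> y \<in> g0 \<Longrightarrow> lbr H.q x y \<in> g0" "x \<in> g0 \<Longrightarrow> y \<in> g1 \<Longrightarrow> lbr H.q x y \<in> g1"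
  "x \<in> g1 \<Longrightarrow> y \<in> g0 \<Longrightarrow> lbr H.q x y \<in> g1" "x \<in> g1 \<Longrightarrow> y \<in> g1 \<Longrightarrow> lbr H.q x y \<in> g0"
  using grading by (simp_all add: Z2_grading_def)

lemma A_lbr: "x \<in> H.K ` B.L2 \<Longrightarrow> A X x = lbr H.q (H.K X) x"
  by (simp add: A_def ad_def H.q_car h_car)

lemma mcomm_parity:
  assumes "X \<in> B.L2" "Y \<in> B.L2"
  shows "H.K X \<in> g0 \<Longrightarrow> H.K Y \<in> g0 \<Longrightarrow> H.K (mcomm X Y) \<in> g0"
    "H.K X \<in> g0 \<Longrightarrow> H.K Y \<in> g1 \<Longrightarrow> H.K (mcomm X Y) \<in> g1"
    "H.K X \<in> g1 \<Longrightarrow> H.K Y \<in> g0 \<Longrightarrow> H.K (mcomm X Y) \<in> g1"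
    "H.K X \<in> g1 \<Longrightarrow> H.K Y \<in> g1 \<Longrightarrow> H.K (mcomm X Y) \<in> g0"
  using bracket_grading H.q_br[of X Y] assms unfolding h_car by metis+

lemma K_both:
  assumes "X \<in> B.L2" "H.K X \<in> g0" "H.K X \<in> g1"
  shows "X \<in> center h"
proof -
  have "H.K X = lzero H.q" using grading assms unfolding Z2_grading_def by blast
  then show ?thesis using assms by (simp add: H.q_zero H.K_eq_iff zero_L2)
qed

lemma K_add:
  assumes "X \<in> B.L2" "Y \<in> B.L2"
  shows "H.K X \<in> g0 \<Longrightarrow> H.K Y \<in> g0 \<Longrightarrow> H.K (X + Y) \<in> g0"
    "H.K X \<in> g1 \<Longrightarrow> H.K Y \<in> g1 \<Longrightarrow> H.K (X + Y) \<in> g1"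
  using grading H.q_add[of X Y] assms unfolding Z2_grading_def subspace_of_def h_car by metis+

lemma central_if:
  assumes X: "X \<in> B.L2" and "\<And>Y. Y \<in> B.L2 \<Longrightarrow> H.K Y \<in> g0 \<Longrightarrow> mcomm X Y \<in> center h"
    and "\<And>Y. Y \<in> B.L2 \<Longrightarrow> H.K Y \<in> g1 \<Longrightarrow> mcomm X Y \<in> center h"
  shows "X \<in> center h"
proof -
  have "X \<in> scalar_mats N"
  proof (rule B.mcomm_center_scalar)
    fix Y assume "Y \<in> B.L2"
    then obtain Y0 Y1 where Y: "Y0 \<in> B.L2" "Y1 \<in> B.L2" "H.K Y0 \<in> g0" "H.K Y1 \<in> g1" "Y = Y0 + Y1"
      using decompose by metis
    then have "mcomm X Y0 + mcomm X Y1 \<in> center h" using assms by simp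
    then show "mcomm X Y \<in> B.Z2" using X Y by (simp add: mcomm_add Z_eq B.Z2_eq)
  qed (use X in simp)
  then show ?thesis using X by (simp add: Z_eq)
qed

text \<open>Parity of a derivation is defined by its action on \<open>g0\<close> and
  \<open>g1\<close>. If \<open>A X\<close> preserves both, then so does the action of the odd
  component \<open>X1\<close> of \<open>X\<close>, which also exchanges them. Its values are zero,
  so \<open>X1\<close> is central and \<open>A X\<close> comes from the even component.\<close>

lemma lev_S: "lev (S_g_one H.q g0 g1) = A ` {X \<in> B.L2. \<Phi> X \<in> mat_ev N a}"
proof (intro subset_antisym subsetI)
  fix D assume "D \<in> lev (S_g_one H.q g0 g1)"
  then have D: "D \<in> A ` B.L2" "D ` g0 \<subseteq> g0" "D ` g1 \<subseteq> g1" by (simp_all add: S_g_one_def g_one_eq)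
  then obtain X where X: "X \<in> B.L2" "D = A X" by blast
  obtain X0 X1 where *: "X0 \<in> B.L2" "X1 \<in> B.L2" "H.K X0 \<in> g0" "H.K X1 \<in> g1" "\<Phi> X0 \<in> mat_ev N a" "X = X0 + X1"
    using decompose[OF X(1)] by metis
  have DK: "H.K (mcomm X Y) = D (H.K Y)" if "Y \<in> B.L2" for Y using A_apply X that by simp
  have "X1 \<in> center h"
  proof (rule central_if)
    fix Y assume Y: "Y \<in> B.L2"
    have eq: "mcomm X1 Y = mcomm X Y + mcomm X0 Y" using * Y by (simp add: mcomm_add mat_ac)
    have L: "mcomm X Y \<in> B.L2" "mcomm X0 Y \<in> B.L2" "mcomm X1 Y \<in> B.L2" using * X Y B.L2_mcomm by blast+
    show "mcomm X1 Y \<in> center h" if y: "H.K Y \<in> g0"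
    proof (rule K_both[OF L(3)])
      show "H.K (mcomm X1 Y) \<in> g1" using mcomm_parity(3)[OF *(2) Y *(4) y] .
      show "H.K (mcomm X1 Y) \<in> g0" unfolding eq
        by (rule K_add(1)[OF L(1,2) _ mcomm_parity(1)[OF *(1) Y *(3) y]]) (use DK[OF Y] D y in auto)
    qed
    show "mcomm X1 Y \<in> center h" if y: "H.K Y \<in> g1"
    proof (rule K_both[OF L(3)])
      show "H.K (mcomm X1 Y) \<in> g0" using mcomm_parity(4)[OF *(2) Y *(4) y] .
      show "H.K (mcomm X1 Y) \<in> g1" unfolding eq
        by (rule K_add(2)[OF L(1,2) _ mcomm_parity(2)[OF *(1) Y *(3) y]]) (use DK[OF Y] D y in auto)
    qed
  qed (use * in simp)
  then have "X + X0 \<in> center h" using * by (simp add: mat_ac)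
  then have "D = A X0" using X * by (simp add: A_eq_iff)
  then show "D \<in> A ` {X \<in> B.L2. \<Phi> X \<in> mat_ev N a}" using * by blast
next
  fix D assume "D \<in> A ` {X \<in> B.L2. \<Phi> X \<in> mat_ev N a}"
  then obtain X where X: "X \<in> B.L2" "\<Phi> X \<in> mat_ev N a" "D = A X" by blast
  have "A X x = lbr H.q (H.K X) x" if "x \<in> g0 \<union> g1" for x
    by (rule A_lbr) (use that gr(1,2) in blast)
  then have "A X ` g0 \<subseteq> g0 \<and> A X ` g1 \<subseteq> g1" using bracket_grading even_g0[OF X(1,2)] by auto
  then show "D \<in> lev (S_g_one H.q g0 g1)" using X by (simp add: S_g_one_def g_one_eq)
qed

text \<open>As for \<open>lev_S\<close> with parities exchanged; now the even component turns out
  central.\<close>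

lemma lodd_S: "lodd (S_g_one H.q g0 g1) = A ` {X \<in> B.L2. \<Phi> X \<in> mat_odd N a}"
proof (intro subset_antisym subsetI)
  fix D assume "D \<in> lodd (S_g_one H.q g0 g1)"
  then have D: "D \<in> A ` B.L2" "D ` g0 \<subseteq> g1" "D ` g1 \<subseteq> g0" by (simp_all add: S_g_one_def g_one_eq)
  then obtain X where X: "X \<in> B.L2" "D = A X" by blast
  obtain X0 X1 where *: "X0 \<in> B.L2" "X1 \<in> B.L2" "H.K X0 \<in> g0" "H.K X1 \<in> g1" "\<Phi> X1 \<in> mat_odd N a" "X = X0 + X1"
    using decompose[OF X(1)] by metis
  have DK: "H.K (mcomm X Y) = D (H.K Y)" if "Y \<in> B.L2" for Y using A_apply X that by simp
  have "X0 \<in> center h"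
  proof (rule central_if)
    fix Y assume Y: "Y \<in> B.L2"
    have eq: "mcomm X0 Y = mcomm X Y + mcomm X1 Y" using * Y by (simp add: mcomm_add mat_ac)
    have L: "mcomm X Y \<in> B.L2" "mcomm X1 Y \<in> B.L2" "mcomm X0 Y \<in> B.L2" using * X Y B.L2_mcomm by blast+
    show "mcomm X0 Y \<in> center h" if y: "H.K Y \<in> g0"
    proof (rule K_both[OF L(3)])
      show "H.K (mcomm X0 Y) \<in> g0" using mcomm_parity(1)[OF *(1) Y *(3) y] .
      show "H.K (mcomm X0 Y) \<in> g1" unfolding eq
        by (rule K_add(2)[OF L(1,2) _ mcomm_parity(3)[OF *(2) Y *(4) y]]) (use DK[OF Y] D y in auto)
    qed
    show "mcomm X0 Y \<in> center h" if y: "H.K Y \<in> g1"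
    proof (rule K_both[OF L(3)])
      show "H.K (mcomm X0 Y) \<in> g1" using mcomm_parity(2)[OF *(1) Y *(3) y] .
      show "H.K (mcomm X0 Y) \<in> g0" unfolding eq
        by (rule K_add(1)[OF L(1,2) _ mcomm_parity(4)[OF *(2) Y *(4) y]]) (use DK[OF Y] D y in auto)
    qed
  qed (use * in simp)
  then have "X + X1 \<in> center h" using * by (simp add: mat_ac)
  then have "D = A X1" using X * by (simp add: A_eq_iff)
  then show "D \<in> A ` {X \<in> B.L2. \<Phi> X \<in> mat_odd N a}" using * by blast
next
  fix D assume "D \<in> A ` {X \<in> B.L2. \<Phi> X \<in> mat_odd N a}"
  then obtain X where X: "X \<in> B.L2" "\<Phi> X \<in> mat_odd N a" "D = A X" by blast
  have "A X x = lbr H.q (H.K X) x" if "x \<in> g0 \<union> g1" for x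
    by (rule A_lbr) (use that gr(1,2) in blast)
  then have "A X ` g0 \<subseteq> g1 \<and> A X ` g1 \<subseteq> g0" using bracket_grading odd_g1[OF X(1,2)] by auto
  then show "D \<in> lodd (S_g_one H.q g0 g1)" using X by (simp add: S_g_one_def g_one_eq)
qed

definition iso where "iso D = H'.K (\<Phi> (SOME X. X \<in> B.L2 \<and> D = A X))"

lemma iso_A:
  assumes X: "X \<in> B.L2"
  shows "iso (A X) = H'.K (\<Phi> X)"
proof -
  define Y where "Y = (SOME Y. Y \<in> B.L2 \<and> A X = A Y)"
  have Y: "Y \<in> B.L2 \<and> A X = A Y" unfolding Y_def by (rule someI[of _ X]) (use X in simp)
  then have "\<Phi> (X + Y) \<in> center h'" using X A_eq_iff \<Phi>_Z by blast
  then have "H'.K (\<Phi> Y) = H'.K (\<Phi> X)" using X Y by (subst H'.K_eq_iff) (simp_all add: \<Phi>_add mat_ac)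
  then show ?thesis by (simp add: iso_def Y_def)
qed

text \<open>Squaring in \<open>quot\<close> chooses an odd representative. There is only one, since
  two of them differ by a scalar matrix that is odd and hence zero.\<close>

lemma lsq_odd:
  assumes Y: "Y \<in> T.L2" "Y \<in> mat_odd N a"
  shows "lsq H'.q (H'.K Y) = H'.K (Y * Y)"
proof -
  have "(SOME x. x \<in> H'.K Y \<inter> lodd h') = Y"
  proof (rule some_equality)
    show "Y \<in> H'.K Y \<inter> lodd h'" using Y by (simp add: H'.mem_K h'_odd)
    fix x assume "x \<in> H'.K Y \<inter> lodd h'"
    then have x: "x \<in> CM" "Y + x \<in> center h'" "x \<in> mat_odd N a" using Y by (simp_all add: H'.mem_K h'_odd)
    then have "Y + x = 0\<^sub>m N N" using Y B.mat_ev_odd[OF Z'_ev B.mat_odd_add] by simp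
    then show "x = Y" using Y x by (simp add: mat_add_eq_zero)
  qed
  then show ?thesis by (simp add: quot_def H'.o)
qed

lemma S_g_one_iso: "lsa_iso (S_g_one H.q g0 g1) H'.q"
  unfolding lsa_iso_def
proof (intro exI[of _ iso] conjI ballI allI)
  let ?S = "S_g_one H.q g0 g1"
  have car: "lcar ?S = A ` B.L2" by (simp add: S_g_one_def g_one_eq)
  \<comment> \<open>Taking for \<open>R\<close> all matrices, the even ones or the odd ones yields
    the carrier and its two components.\<close>
  have im: "\<Phi> ` {X \<in> B.L2. \<Phi> X \<in> R} = T.L2 \<inter> R" for R
  proof (intro subset_antisym subsetI)
    fix Y assume "Y \<in> T.L2 \<inter> R"
    then have "\<Psi> Y \<in> {X \<in> B.L2. \<Phi> X \<in> R}" "Y = \<Phi> (\<Psi> Y)" by simp_all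
    then show "Y \<in> \<Phi> ` {X \<in> B.L2. \<Phi> X \<in> R}" by blast
  qed auto
  have isoim: "iso ` (A ` {X \<in> B.L2. \<Phi> X \<in> R}) = H'.K ` (T.L2 \<inter> R)" for R
  proof -
    have "iso ` (A ` {X \<in> B.L2. \<Phi> X \<in> R}) = (\<lambda>X. H'.K (\<Phi> X)) ` {X \<in> B.L2. \<Phi> X \<in> R}"
      unfolding image_image by (rule image_cong) (simp_all add: iso_A)
    then show ?thesis unfolding im[symmetric] image_image .
  qed
  show "bij_betw iso (lcar ?S) (lcar H'.q)"
    unfolding bij_betw_def
  proof
    show "inj_on iso (lcar ?S)"
    proof (rule inj_onI)
      fix D E assume "D \<in> lcar ?S" "E \<in> lcar ?S" and eq: "iso D = iso E"
      then obtain X Y where XY: "X \<in> B.L2" "Y \<in> B.L2" "D = A X" "E = A Y" by (auto simp: car)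
      then have "\<Phi> X + \<Phi> Y \<in> center h'" using eq by (simp add: iso_A H'.K_eq_iff)
      then have "X + Y \<in> center h" using XY \<Phi>_Z_iff[of "X + Y"] by (simp add: \<Phi>_add)
      then show "D = E" using XY by (simp add: A_eq_iff)
    qed
    show "iso ` lcar ?S = lcar H'.q" using isoim[of UNIV] by (simp add: car H'.q_car h'_car)
  qed
  show "iso ` lev ?S = lev H'.q"
    unfolding lev_S isoim by (simp add: quot_def h'_ev)
  show "iso ` lodd ?S = lodd H'.q"
    unfolding lodd_S isoim by (simp add: quot_def h'_odd)
  show "iso (ladd ?S D E) = ladd H'.q (iso D) (iso E)" if "D \<in> lcar ?S" "E \<in> lcar ?S" for D E
  proof -
    obtain X Y where XY: "X \<in> B.L2" "Y \<in> B.L2" "D = A X" "E = A Y" using \<open>D \<in> lcar ?S\<close> \<open>E \<in> lcar ?S\<close> by (auto simp: car)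
    then show ?thesis
      by (simp add: S_g_one_def fun_add_A iso_A mat_derived_add \<Phi>_add H'.q_add h'_car)
  qed
  show "iso (lsmul ?S c D) = lsmul H'.q c (iso D)" if "D \<in> lcar ?S" for c D
  proof -
    obtain X where X: "X \<in> B.L2" "D = A X" using \<open>D \<in> lcar ?S\<close> by (auto simp: car)
    then show ?thesis
      by (simp add: S_g_one_def fun_smul_A iso_A mat_derived_smult \<Phi>_smult H'.q_smul h'_car)
  qed
  show "iso (lbr ?S D E) = lbr H'.q (iso D) (iso E)" if "D \<in> lcar ?S" "E \<in> lcar ?S" for D E
  proof -
    obtain X Y where XY: "X \<in> B.L2" "Y \<in> B.L2" "D = A X" "E = A Y" using \<open>D \<in> lcar ?S\<close> \<open>E \<in> lcar ?S\<close> by (auto simp: car)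
    then show ?thesis
      by (simp add: S_g_one_def fun_br_A iso_A B.L2_mcomm \<Phi>_mcomm H'.q_br h'_car)
  qed
  show "iso (lsq ?S D) = lsq H'.q (iso D)" if "D \<in> lodd ?S" for D
  proof -
    obtain X where X: "X \<in> B.L2" "\<Phi> X \<in> mat_odd N a" "D = A X" using \<open>D \<in> lodd ?S\<close> by (auto simp: lodd_S)
    then show ?thesis
      using A_square[of X] odd_square[of X] lsq_odd[of "\<Phi> X"]
      by (simp add: S_g_one_def iso_A \<Phi>_mult)
  qed
qed

end

section \<open>Classification of the gradings\<close>

text \<open>The involution of the block Gram matrix with blocks \<open>Pi_mat (2 * k)\<close> and
  \<open>Pi_mat (2 * n - 2 * k)\<close>. For \<open>k = 0\<close> it exchanges i and i + n, the form
  common to \<open>o_Pi\<close> and \<open>pe\<close>.\<close>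

definition oo_inv :: "nat \<Rightarrow> nat \<Rightarrow> nat \<Rightarrow> nat" where
  "oo_inv n k i = (if i < k then i + k else if i < 2 * k then i - k
     else if i < n + k then i + (n - k) else i - (n - k))"

lemma gram_eq_inv_mat:
  assumes k: "k \<le> n"
  shows "(gram (2 * k) (2 * n - 2 * k) :: 'a::field mat) = inv_mat (2 * n) (oo_inv n k)"
proof (rule eq_matI)
  obtain m where n: "n = k + m" using k le_Suc_ex by blast
  have h: "2 * (k + m) - 2 * k = 2 * m" by simp
  fix i j
  assume "i < dim_row (inv_mat (2 * n) (oo_inv n k) :: 'a mat)" "j < dim_col (inv_mat (2 * n) (oo_inv n k) :: 'a mat)"
  then have ij: "i < 2 * n" "j < 2 * n" by (simp_all add: inv_mat_def)
  have g: "gram (2 * k) (2 * n - 2 * k) $$ (i, j) = (if i < 2 * k \<and> j < 2 * k then Pi_entry (2 * k) i j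
      else if 2 * k \<le> i \<and> 2 * k \<le> j then Pi_entry (2 * m) (i - 2 * k) (j - 2 * k) else 0 :: 'a)"
    using ij by (simp add: gram_def n)
  have r: "inv_mat (2 * n) (oo_inv n k) $$ (i, j) = (if j = oo_inv n k i then 1 else 0 :: 'a)"
    using ij by (simp add: inv_mat_def)
  show "gram (2 * k) (2 * n - 2 * k) $$ (i, j) = (inv_mat (2 * n) (oo_inv n k) $$ (i, j) :: 'a)"
  proof (cases "i < 2 * k")
    case True
    then show ?thesis unfolding g r Pi_entry_def oo_inv_def by (cases "j < 2 * k") (simp_all, arith+)
  next
    case False
    then obtain i' where i: "i = 2 * k + i'" by (metis le_Suc_ex linorder_not_less)
    have i': "i' < 2 * m" using ij n i by simp
    have inv: "oo_inv n k i = 2 * k + (if i' < m then i' + m else i' - m)"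
      by (auto simp: oo_inv_def i n)
    show ?thesis
    proof (cases "j < 2 * k")
      case True
      then show ?thesis using False unfolding g r inv by simp
    next
      case False
      then obtain j' where j: "j = 2 * k + j'" by (metis le_Suc_ex linorder_not_less)
      have "j = oo_inv n k i \<longleftrightarrow> (i' < m \<and> j' = i' + m) \<or> (m \<le> i' \<and> i' + m = j' + 2 * m)"
        unfolding inv j by auto
      then show ?thesis unfolding g r by (simp add: i j Pi_entry_def)
    qed
  qed
qed (use k in \<open>simp_all add: gram_def inv_mat_def\<close>)

lemma Pi_mat_eq_inv_mat: "Pi_mat (2 * n) = inv_mat (2 * n) (oo_inv n 0)"
  by (rule eq_matI) (auto simp: Pi_mat_def inv_mat_def Pi_entry_def oo_inv_def)

lemma involution_form_oo_inv:
  assumes "CHAR('a::field) = 2" "k \<le> n" "n > 2"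
  shows "involution_form TYPE('a) (2 * n) (oo_inv n k)"
  by unfold_locales (use assms in \<open>auto simp: oo_inv_def\<close>)

text \<open>An Artin-Schreier equation; its root is the scalar that makes \<open>M\<close>
  idempotent.\<close>

lemma quadratic_root:
  fixes c :: "'a::alg_closed_field"
  shows "\<exists>x. x * x + x = c"
proof -
  have "degree [:- c, 1, 1:] > 0" by simp
  then obtain x where "poly [:- c, 1, 1:] x = 0" using alg_closed_imp_poly_has_root by blast
  then have "x * x + x = c" by (simp add: algebra_simps)
  then show ?thesis ..
qed

section \<open>Scalar shifts and the two kinds of adapted basis\<close>

context involution_form
begin

lemma G_square: "G * G = 1\<^sub>m N"
proof (rule eq_matI)
  fix i j assume "i < dim_row (1\<^sub>m N :: 'a mat)" "j < dim_col (1\<^sub>m N :: 'a mat)"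
  then have ij: "i < N" "j < N" by simp_all
  show "(G * G) $$ (i, j) = 1\<^sub>m N $$ (i, j)"
    unfolding mult_G_entry(1)[OF inv_mat_carrier ij] using ij by (simp add: inv_mat_def)
qed (simp_all add: inv_mat_def)

lemma shift_multiplier:
  assumes M: "M \<in> CM" and adj: "transpose_mat M * G + G * M = c \<cdot>\<^sub>m G"
  shows "transpose_mat (M + s \<cdot>\<^sub>m 1\<^sub>m N) * G + G * (M + s \<cdot>\<^sub>m 1\<^sub>m N) = c \<cdot>\<^sub>m G"
proof -
  have "transpose_mat (M + s \<cdot>\<^sub>m 1\<^sub>m N) = transpose_mat M + s \<cdot>\<^sub>m 1\<^sub>m N"
    using M by (intro eq_matI) auto
  then have "transpose_mat (M + s \<cdot>\<^sub>m 1\<^sub>m N) * G + G * (M + s \<cdot>\<^sub>m 1\<^sub>m N)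
    = (transpose_mat M * G + s \<cdot>\<^sub>m G) + (G * M + s \<cdot>\<^sub>m G)"
    using M by (simp add: mat_distrib mat_smult left_mult_one_mat[of _ N N] right_mult_one_mat[of _ N N])
  also have "\<dots> = transpose_mat M * G + G * M"
    using M by (simp add: mat_ac)
  finally show ?thesis using adj by simp
qed

lemma mcomm_shift: "M \<in> CM \<Longrightarrow> X \<in> CM \<Longrightarrow> mcomm (M + s \<cdot>\<^sub>m 1\<^sub>m N) X = mcomm M X"
  by (simp add: mcomm_add mcomm_scalar)

text \<open>The cross terms cancel, so the square of \<open>M + s\<close> is \<open>M\<close> plus
  the scalar l + s * s, and this scalar equals s.\<close>

lemma square_shift:
  assumes "M \<in> CM" "M * M + M = l \<cdot>\<^sub>m 1\<^sub>m N" "s * s + s = l"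
  shows "(M + s \<cdot>\<^sub>m 1\<^sub>m N) * (M + s \<cdot>\<^sub>m 1\<^sub>m N) = M + s \<cdot>\<^sub>m 1\<^sub>m N"
proof -
  have "(M + s \<cdot>\<^sub>m 1\<^sub>m N) * (M + s \<cdot>\<^sub>m 1\<^sub>m N) = M * M + (s * s) \<cdot>\<^sub>m 1\<^sub>m N"
  proof -
    have "s \<cdot>\<^sub>m (s \<cdot>\<^sub>m 1\<^sub>m N) = (s * s) \<cdot>\<^sub>m 1\<^sub>m N" by (rule eq_matI) auto
    then show ?thesis using assms(1) by (simp add: square_add mcomm_scalar mat_smult)
  qed
  also have "M * M = M + l \<cdot>\<^sub>m 1\<^sub>m N"
    using assms(1,2) by (metis mat_add_comm mat_add_self_left mat_mult_closed)
  also have "M + l \<cdot>\<^sub>m 1\<^sub>m N + (s * s) \<cdot>\<^sub>m 1\<^sub>m N = M + s \<cdot>\<^sub>m 1\<^sub>m N"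
    using assms(1,3) by (intro eq_matI) (auto simp: add_ac)
  finally show ?thesis .
qed

lemma mv_shift: "r < N \<Longrightarrow> M \<in> CM \<Longrightarrow> mv (M + 1\<^sub>m N) x r = mv M x r + x r"
proof -
  assume r: "r < N" and M: "M \<in> CM"
  have "mv (M + 1\<^sub>m N) x r = mv M x r + (\<Sum>s<N. if s = r then x s else 0)"
    unfolding mv_def sum.distrib[symmetric] by (rule sum.cong) (use r M in \<open>auto simp: distrib_right\<close>)
  then show ?thesis using r by simp
qed

text \<open>With multiplier 0 both members of a pair have the same eigenvalue, and adding the
  identity exchanges the pairs of eigenvalue 0 with those of eigenvalue 1.\<close>

lemma darboux_shift:
  assumes "M \<in> CM" "darboux M 0 n u v e"
  shows "darboux (M + 1\<^sub>m N) 0 n u v (\<lambda>i. e i + 1)"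
  using assms unfolding darboux_def by (auto simp: mv_shift distrib_right)

text \<open>With multiplier 0, whole pairs lie in the kernel or in the image of \<open>M\<close>.
  The \<open>k\<close> pairs in the kernel become the even block of size
  \<open>2 * k\<close>.\<close>

lemma adapted_basis_oo:
  assumes N: "N = 2 * n" and M: "M \<in> CM" and dar: "darboux M 0 n u v e"
  defines "k \<equiv> card {i. i < n \<and> e i = 0}"
  shows "\<exists>P\<in>CM. transpose_mat P * G * P = inv_mat N (oo_inv n k) \<and> M * P = P * parity_mat N (2 * k)"
proof -
  let ?A = "{i. i < n \<and> e i = 0}" and ?B = "{i. i < n \<and> e i \<noteq> 0}"
  have kn: "k \<le> n" unfolding k_def using card_mono[of "{..<n}" ?A] by auto
  have "card ?A + card ?B = card (?A \<union> ?B)" by (rule card_Un_disjoint[symmetric]) auto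
  also have "?A \<union> ?B = {..<n}" by auto
  finally have cB: "card ?B = n - k" by (simp add: k_def)
  \<comment> \<open>A renumbering \<open>f\<close> of the pairs is assembled that lists those with
    eigenvalue 0 first.\<close>
  obtain f1 where f1: "bij_betw f1 {..<k} ?A"
    using finite_same_card_bij[of "{..<k}" ?A] by (auto simp: k_def)
  obtain f2 where f2: "bij_betw f2 {k..<n} ?B"
    using finite_same_card_bij[of "{k..<n}" ?B] by (auto simp: cB)
  define f where "f i = (if i < k then f1 i else f2 i)" for i
  have f1A: "f1 i \<in> ?A" if "i < k" for i using f1 that by (auto dest: bij_betwE)
  have f2B: "f2 i \<in> ?B" if "k \<le> i" "i < n" for i using f2 that by (auto dest: bij_betwE)
  have fn: "f i < n" if "i < n" for i using f1A f2B that by (auto simp: f_def)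
  have fe: "e (f i) = (if i < k then 0 else 1)" if i: "i < n" for i
  proof -
    have "e (f i) \<in> {0, 1}" using dar fn[OF i] by (simp add: darboux_def)
    then show ?thesis using f1A[of i] f2B[of i] i by (auto simp: f_def)
  qed
  have finj: "f i = f j \<longleftrightarrow> i = j" if "i < n" "j < n" for i j
  proof
    assume eq: "f i = f j"
    then have "i < k \<longleftrightarrow> j < k" using fe[OF that(1)] fe[OF that(2)] by (auto split: if_splits)
    then show "i = j"
      using eq that inj_onD[OF bij_betw_imp_inj_on[OF f1], of i j] inj_onD[OF bij_betw_imp_inj_on[OF f2], of i j]
      by (cases "i < k") (auto simp: f_def)
  qed simp
  \<comment> \<open>The columns are arranged in four runs: the \<open>u\<close> and then the
    \<open>v\<close> of the first \<open>k\<close> pairs, followed by the \<open>u\<close> and then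
    the \<open>v\<close> of the others, as the two blocks of \<open>oo_inv n k\<close>
    require.\<close>
  define p where "p i = (if i < k then i else if i < n + k then i - k else i - n)" for i
  define t where "t i \<longleftrightarrow> (k \<le> i \<and> i < 2 * k) \<or> n + k \<le> i" for i
  have pn: "p i < n" if "i < N" for i using that kn N by (auto simp: p_def)
  have pk: "p i < k \<longleftrightarrow> i < 2 * k" if "i < N" for i using that kn N by (auto simp: p_def)
  have \<tau>: "(f (p i) = f (p j) \<and> t i \<noteq> t j) \<longleftrightarrow> j = oo_inv n k i" if "i < N" "j < N" for i j
    unfolding finj[OF pn[OF that(1)] pn[OF that(2)]] using that kn N
    by (auto simp: p_def t_def oo_inv_def)
  note D = darboux_matrix[OF M dar fn[OF pn] \<tau>]
  have "mat N N (\<lambda>(i, j). if i = j then (if t i then e (f (p i)) + 0 else e (f (p i))) else 0) = parity_mat N (2 * k)"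
    using fe[OF pn] pk by (intro eq_matI) (auto simp: parity_mat_def)
  then show ?thesis
    using D by (intro bexI[of _ "mat N N (\<lambda>(r, i). if t i then v (f (p i)) r else u (f (p i)) r)"]) simp_all
qed

text \<open>With multiplier 1 every \<open>u i\<close> has eigenvalue 0 and every \<open>v i\<close>
  eigenvalue 1. Listing all \<open>u\<close> before all \<open>v\<close> therefore separates
  parities at \<open>n\<close>, and pairs i with i + n.\<close>

lemma adapted_basis_pe:
  assumes N: "N = 2 * n" and M: "M \<in> CM" and dar: "darboux M 1 n u v e"
  shows "\<exists>P\<in>CM. transpose_mat P * G * P = inv_mat N (oo_inv n 0) \<and> M * P = P * parity_mat N n"
proof -
  define p where "p i = (if i < n then i else i - n)" for i :: nat
  define t where "t i \<longleftrightarrow> n \<le> i" for i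
  have pn: "p i < n" if "i < N" for i using that N by (auto simp: p_def)
  have \<tau>: "(p i = p j \<and> t i \<noteq> t j) \<longleftrightarrow> j = oo_inv n 0 i" if "i < N" "j < N" for i j
    using that N by (auto simp: p_def t_def oo_inv_def)
  note D = darboux_matrix[OF M dar pn \<tau>]
  have "e i = 0" if "i < n" for i using dar that by (simp add: darboux_def)
  then have "mat N N (\<lambda>(i, j). if i = j then (if t i then e (p i) + 1 else e (p i)) else 0) = parity_mat N n"
    using pn by (intro eq_matI) (auto simp: parity_mat_def t_def)
  then show ?thesis
    using D by (intro bexI[of _ "mat N N (\<lambda>(r, i). if t i then v (p i) r else u (p i) r)"]) simp_all
qed

text \<open>One of the two eigenvalues belongs to at most half of the pairs. The shift
  \<open>s\<close> is 0 or 1 and makes that eigenvalue 0, which gives the bound on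
  \<open>k\<close>.\<close>

lemma adapted_basis:
  assumes N: "N = 2 * n" and M: "M \<in> CM" "M * M = M" and adj: "transpose_mat M * G + G * M = c \<cdot>\<^sub>m G"
  shows "(\<exists>k\<le>n div 2. \<exists>s. \<exists>P\<in>CM. transpose_mat P * G * P = inv_mat N (oo_inv n k)
            \<and> (M + s \<cdot>\<^sub>m 1\<^sub>m N) * P = P * parity_mat N (2 * k))
       \<or> (\<exists>P\<in>CM. transpose_mat P * G * P = inv_mat N (oo_inv n 0) \<and> M * P = P * parity_mat N n)"
proof -
  have c: "c \<in> {0, 1}" by (rule idempotent_multiplier[OF M adj])
  obtain u v e where dar: "darboux M c n u v e" using darboux_exists[OF M adj c, of n] N by auto
  show ?thesis
  proof (cases "c = 1")
    case True
    then show ?thesis using adapted_basis_pe[OF N M(1)] dar by blast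
  next
    case False
    then have c0: "c = 0" using c by simp
    show ?thesis
    proof (cases "card {i. i < n \<and> e i = 0} \<le> n div 2")
      case True
      have "M + 0 \<cdot>\<^sub>m 1\<^sub>m N = M" using M by (intro eq_matI) auto
      then show ?thesis using adapted_basis_oo[OF N M(1) dar[unfolded c0]] True by metis
    next
      case False
      have e01: "e i \<in> {0, 1}" if "i < n" for i using dar that by (simp add: darboux_def)
      have "card {i. i < n \<and> e i = 0} + card {i. i < n \<and> e i + 1 = 0} = card ({i. i < n \<and> e i = 0} \<union> {i. i < n \<and> e i + 1 = 0})"
        by (rule card_Un_disjoint[symmetric]) auto
      also have "\<dots> \<le> card {..<n}" by (rule card_mono) auto
      finally have "card {i. i < n \<and> e i + 1 = 0} \<le> n div 2" using False by simp
      moreover have "M + 1 \<cdot>\<^sub>m 1\<^sub>m N = M + 1\<^sub>m N" using M by (intro eq_matI) auto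
      moreover have "M + 1\<^sub>m N \<in> CM" using M by simp
      ultimately show ?thesis
        using adapted_basis_oo[OF N _ darboux_shift[OF M(1) dar[unfolded c0]]] by metis
    qed
  qed
qed

end

section \<open>The derivation attached to a grading\<close>

context mat_lie
begin

text \<open>\<open>D\<close> is the projection to the odd component. The Leibniz rule is special to
  characteristic 2: on two odd elements it demands that 2 [x, y] vanish.\<close>

lemma grading_derivation:
  assumes gr: "Z2_grading q g0 g1"
  shows "\<exists>D. is_derivation q D \<and> (\<forall>x\<in>g0. D x = lzero q) \<and> (\<forall>x\<in>g1. D x = x) \<and> (\<forall>x\<in>lcar q. D (D x) = D x)"
proof -
  define D where "D y = (if y \<in> lcar q then (SOME x1. x1 \<in> g1 \<and> (\<exists>x0\<in>g0. y = ladd q x0 x1)) else lzero q)" for y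
  have sub: "g0 \<subseteq> K ` lcar h" "g1 \<subseteq> K ` lcar h"
    and zero: "lzero q \<in> g0" "lzero q \<in> g1"
    and add: "\<And>x y. x \<in> g0 \<Longrightarrow> y \<in> g0 \<Longrightarrow> ladd q x y \<in> g0" "\<And>x y. x \<in> g1 \<Longrightarrow> y \<in> g1 \<Longrightarrow> ladd q x y \<in> g1"
    and smul: "\<And>c x. x \<in> g0 \<Longrightarrow> lsmul q c x \<in> g0" "\<And>c x. x \<in> g1 \<Longrightarrow> lsmul q c x \<in> g1"
    and inter: "g0 \<inter> g1 = {lzero q}"
    and dec: "\<And>x. x \<in> lcar q \<Longrightarrow> \<exists>x0\<in>g0. \<exists>x1\<in>g1. x = ladd q x0 x1"
    and brk: "\<And>x y. x \<in> g0 \<Longrightarrow> y \<in> g0 \<Longrightarrow> lbr q x y \<in> g0" "\<And>x y. x \<in> g0 \<Longrightarrow> y \<in> g1 \<Longrightarrow> lbr q x y \<in> g1"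
      "\<And>x y. x \<in> g1 \<Longrightarrow> y \<in> g0 \<Longrightarrow> lbr q x y \<in> g1" "\<And>x y. x \<in> g1 \<Longrightarrow> y \<in> g1 \<Longrightarrow> lbr q x y \<in> g0"
    using gr unfolding Z2_grading_def subspace_of_def q_car[symmetric] by simp_all
  have rep: "\<exists>X\<in>lcar h. x = K X" if "x \<in> g0 \<union> g1" for x using that sub by blast
  have car: "K X \<in> lcar q" if "X \<in> lcar h" for X using that q_car by simp
  have uniq: "x1 = y1" if xy: "x0 \<in> g0" "x1 \<in> g1" "y0 \<in> g0" "y1 \<in> g1" "ladd q x0 x1 = ladd q y0 y1" for x0 x1 y0 y1
  proof -
    obtain X0 X1 Y0 Y1 where X: "X0 \<in> lcar h" "X1 \<in> lcar h" "Y0 \<in> lcar h" "Y1 \<in> lcar h"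
      "x0 = K X0" "x1 = K X1" "y0 = K Y0" "y1 = K Y1" using rep xy by (metis UnI1 UnI2)
    have "(X0 + X1) + (Y0 + Y1) \<in> Z" using xy(5) X by (simp add: q_add K_eq_iff)
    moreover have "(X0 + X1) + (Y0 + Y1) = (X0 + Y0) + (X1 + Y1)" using X by (simp add: mat_ac)
    ultimately have eq: "K (X0 + Y0) = K (X1 + Y1)" using X by (simp add: K_eq_iff)
    have "K (X0 + Y0) \<in> g0" "K (X1 + Y1) \<in> g1" using add(1)[OF xy(1,3)] add(2)[OF xy(2,4)] X by (simp_all add: q_add)
    then have "K (X1 + Y1) = K (0\<^sub>m N N)" using eq inter unfolding q_zero by auto
    then have "X1 + Y1 \<in> Z" using X by (simp add: K_eq_iff)
    then show ?thesis using X by (simp add: K_eq_iff)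
  qed
  have lcar_add: "ladd q x y \<in> lcar q" if "x \<in> lcar q" "y \<in> lcar q" for x y
    using that unfolding q_car by (auto simp: q_add)
  have g_car: "x \<in> lcar q" if "x \<in> g0 \<union> g1" for x using that sub q_car by blast
  have D_add: "D (ladd q x0 x1) = x1" if x: "x0 \<in> g0" "x1 \<in> g1" for x0 x1
  proof -
    have "(SOME y1. y1 \<in> g1 \<and> (\<exists>y0\<in>g0. ladd q x0 x1 = ladd q y0 y1)) = x1"
      by (rule some_equality) (use x uniq in blast)+
    then show ?thesis using lcar_add[OF g_car g_car, of x0 x1] x by (simp add: D_def)
  qed
  have zl: "ladd q (lzero q) x = x" "ladd q x (lzero q) = x" if "x \<in> lcar q" for x
    using that unfolding q_car q_zero by (auto simp: q_add)
  have D0: "D x = lzero q" if "x \<in> g0" for x using D_add[OF that zero(2)] zl(2)[of x] g_car that by simp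
  have D1: "D x = x" if "x \<in> g1" for x using D_add[OF zero(1) that] zl(1)[of x] g_car that by simp
  have split: "\<exists>X0 X1. X0 \<in> lcar h \<and> X1 \<in> lcar h \<and> K X0 \<in> g0 \<and> K X1 \<in> g1 \<and> x = K (X0 + X1) \<and> D x = K X1"
    if x: "x \<in> lcar q" for x
  proof -
    obtain x0 x1 where *: "x0 \<in> g0" "x1 \<in> g1" "x = ladd q x0 x1" using dec[OF x] by blast
    then obtain X0 X1 where X: "X0 \<in> lcar h" "X1 \<in> lcar h" "x0 = K X0" "x1 = K X1" using rep by (metis UnI1 UnI2)
    then show ?thesis using * D_add[OF *(1,2)] by (intro exI[of _ X0] exI[of _ X1]) (simp add: q_add)
  qed
  have DK: "D (K (X0 + X1)) = K X1" if "X0 \<in> lcar h" "X1 \<in> lcar h" "K X0 \<in> g0" "K X1 \<in> g1" for X0 X1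
    using D_add[OF that(3,4)] that by (simp add: q_add)
  have "is_derivation q D"
    unfolding is_derivation_def
  proof (intro conjI allI impI ballI)
    show "D x = lzero q" if "x \<notin> lcar q" for x using that by (simp add: D_def)
    show "D x \<in> lcar q" if "x \<in> lcar q" for x using split[OF that] car by auto
    fix x assume x: "x \<in> lcar q"
    obtain X0 X1 where X: "X0 \<in> lcar h" "X1 \<in> lcar h" "K X0 \<in> g0" "K X1 \<in> g1" "x = K (X0 + X1)" "D x = K X1"
      using split[OF x] by blast
    show "D (lsmul q c x) = lsmul q c (D x)" for c
    proof -
      have "lsmul q c x = K (c \<cdot>\<^sub>m X0 + c \<cdot>\<^sub>m X1)" using X by (simp add: q_smul mat_smult)
      moreover have "K (c \<cdot>\<^sub>m X0) \<in> g0" "K (c \<cdot>\<^sub>m X1) \<in> g1"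
        using smul(1)[OF X(3), of c] smul(2)[OF X(4), of c] X by (simp_all add: q_smul)
      ultimately show ?thesis using X DK[of "c \<cdot>\<^sub>m X0" "c \<cdot>\<^sub>m X1"] by (simp add: q_smul)
    qed
    fix y assume y: "y \<in> lcar q"
    obtain Y0 Y1 where Y: "Y0 \<in> lcar h" "Y1 \<in> lcar h" "K Y0 \<in> g0" "K Y1 \<in> g1" "y = K (Y0 + Y1)" "D y = K Y1"
      using split[OF y] by blast
    show "D (ladd q x y) = ladd q (D x) (D y)"
    proof -
      have "ladd q x y = K ((X0 + Y0) + (X1 + Y1))" using X Y by (simp add: q_add mat_ac)
      moreover have "K (X0 + Y0) \<in> g0" "K (X1 + Y1) \<in> g1"
        using add(1)[OF X(3) Y(3)] add(2)[OF X(4) Y(4)] X Y by (simp_all add: q_add)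
      ultimately show ?thesis using X Y DK[of "X0 + Y0" "X1 + Y1"] by (simp add: q_add)
    qed
    show "D (lbr q x y) = ladd q (lbr q (D x) y) (lbr q x (D y))"
    proof -
      have m: "mcomm X0 Y0 \<in> lcar h" "mcomm X0 Y1 \<in> lcar h" "mcomm X1 Y0 \<in> lcar h" "mcomm X1 Y1 \<in> lcar h"
        using X Y br by blast+
      have "lbr q x y = K (mcomm (X0 + X1) (Y0 + Y1))" using X Y by (simp add: q_br)
      also have "mcomm (X0 + X1) (Y0 + Y1) = (mcomm X0 Y0 + mcomm X1 Y1) + (mcomm X0 Y1 + mcomm X1 Y0)"
        using X Y by (simp add: mcomm_add mat_ac)
      finally have 1: "lbr q x y = K ((mcomm X0 Y0 + mcomm X1 Y1) + (mcomm X0 Y1 + mcomm X1 Y0))" .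
      have "K (mcomm X0 Y0) \<in> g0" "K (mcomm X1 Y1) \<in> g0" "K (mcomm X0 Y1) \<in> g1" "K (mcomm X1 Y0) \<in> g1"
        using brk(1)[OF X(3) Y(3)] brk(4)[OF X(4) Y(4)] brk(2)[OF X(3) Y(4)] brk(3)[OF X(4) Y(3)] X Y
        by (simp_all add: q_br)
      then have "K (mcomm X0 Y0 + mcomm X1 Y1) \<in> g0" "K (mcomm X0 Y1 + mcomm X1 Y0) \<in> g1"
        using add m by (simp_all flip: q_add)
      then have "D (lbr q x y) = K (mcomm X0 Y1 + mcomm X1 Y0)"
        unfolding 1 using m by (intro DK) simp_all
      moreover have "ladd q (lbr q (D x) y) (lbr q x (D y)) = K (mcomm X1 (Y0 + Y1) + mcomm (X0 + X1) Y1)"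
        using X Y br by (simp add: q_br q_add)
      \<comment> \<open>The two copies of \<open>mcomm X1 Y1\<close> cancel, leaving exactly the odd
        part of the bracket.\<close>
      moreover have "mcomm X1 (Y0 + Y1) + mcomm (X0 + X1) Y1 = mcomm X0 Y1 + mcomm X1 Y0"
        using X Y by (simp add: mcomm_add mat_ac)
      ultimately show ?thesis by simp
    qed
  qed
  moreover have "D (D x) = D x" if "x \<in> lcar q" for x using split[OF that] D1 by auto
  ultimately show ?thesis using D0 D1 by blast
qed

end

lemma graded_quotient_iso:
  fixes h h' :: "('a::field, 'a mat) lsa" and M P :: "'a mat"
  assumes B: "involution_form TYPE('a) N \<sigma>" and T: "involution_form TYPE('a) N \<tau>"
    and h: "mat_ops N h" "lcar h = mat_derived N (mat_derived N (form_lie N (inv_mat N \<sigma>)))"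
    and h': "mat_ops N h'" "lcar h' = mat_derived N (mat_derived N (form_lie N (inv_mat N \<tau>)))"
      "lev h' = lcar h' \<inter> mat_ev N a" "lodd h' = lcar h' \<inter> mat_odd N a"
    and P: "P \<in> carrier_mat N N" "transpose_mat P * inv_mat N \<sigma> * P = inv_mat N \<tau>"
    and M: "M \<in> carrier_mat N N" "M * P = P * parity_mat N a"
    and gr: "Z2_grading (quot h (center h)) g0 g1"
    and Mg: "\<And>X. X \<in> lcar h \<Longrightarrow> coset h (center h) X \<in> g0 \<Longrightarrow> mcomm M X \<in> center h"
      "\<And>X. X \<in> lcar h \<Longrightarrow> coset h (center h) X \<in> g1 \<Longrightarrow> mcomm M X + X \<in> center h"
  shows "lsa_iso (S_g_one (quot h (center h)) g0 g1) (quot h' (center h'))"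
proof -
  interpret B: involution_form N "TYPE('a)" \<sigma> by (rule B)
  interpret T: involution_form N "TYPE('a)" \<tau> by (rule T)
  interpret H: mat_lie N "TYPE('a)" h by (rule B.mat_lie_L2[OF h])
  interpret H': mat_lie N "TYPE('a)" h' by (rule T.mat_lie_L2[OF h'(1,2)])
  \<comment> \<open>The inverse of \<open>P\<close> can be read off from the congruence, because
    \<open>T.G\<close> is its own inverse.\<close>
  define Q where "Q = T.G * transpose_mat P * B.G"
  have PT: "transpose_mat P \<in> carrier_mat N N" using P by simp
  have Q: "Q \<in> carrier_mat N N" unfolding Q_def using PT by simp
  have "Q * P = T.G * (transpose_mat P * B.G * P)"
    unfolding Q_def using P PT by (simp add: B.mat_mult_assoc)
  then have QP: "Q * P = 1\<^sub>m N" unfolding P(2) by (simp add: T.G_square)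
  then have PQ: "P * Q = 1\<^sub>m N" using mat_mult_left_right_inverse[OF Q P(1)] by simp
  interpret graded_form N "TYPE('a)" \<sigma> \<tau> h h' a P Q M g0 g1
    by unfold_locales (use h h' P M PQ QP Q gr Mg in simp_all)
  show ?thesis by (rule S_g_one_iso)
qed

theorem theorem5p1:
  fixes n :: nat
    and g0 g1 :: "'a::alg_closed_field mat set set"
  defines "o2 \<equiv> derived (derived (o_Pi (2 * n) :: ('a, 'a mat) lsa))"
  defines "g \<equiv> quot o2 (center o2)"
  assumes char2: "CHAR('a) = 2"
    and n_gt: "n > 2"
    and Der: "\<forall>D. is_derivation g D \<longrightarrow>
               (\<exists>M \<in> o_Pi_tilde (2 * n). \<forall>X \<in> lcar o2.
                  D (coset o2 (center o2) X) = coset o2 (center o2) (M * X - X * M))"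
    and grading: "Z2_grading g g0 g1"
  shows "(\<exists>k \<le> n div 2.
            lsa_iso (S_g_one g g0 g1)
              (let h = derived (derived (oo_PiPi (2 * k) (2 * n - 2 * k) :: ('a, 'a mat) lsa))
               in quot h (center h)))
         \<or> lsa_iso (S_g_one g g0 g1)
              (let h = derived (derived (pe n :: ('a, 'a mat) lsa)) in quot h (center h))"
proof -
  let ?N = "2 * n"
  let ?inv = "\<lambda>k. inv_mat ?N (oo_inv n k) :: 'a mat"
  let ?L2 = "\<lambda>k. mat_derived ?N (mat_derived ?N (form_lie ?N (?inv k)))"
  note form = involution_form_oo_inv[OF char2 _ n_gt]
  have oo: "mat_ops ?N h" "lcar h = ?L2 k" "lev h = lcar h \<inter> mat_ev ?N (2 * k)" "lodd h = lcar h \<inter> mat_odd ?N (2 * k)"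
    if k: "k \<le> n" and h: "h = derived (derived (oo_PiPi (2 * k) (2 * n - 2 * k)))" for k and h :: "('a, 'a mat) lsa"
  proof -
    have N: "2 * k + (2 * n - 2 * k) = ?N" using k by simp
    have "{X \<in> carrier_mat ?N ?N. transpose_mat X * ?inv k + ?inv k * X = 0\<^sub>m ?N ?N} = form_lie ?N (?inv k)"
      by (simp add: form_lie_def)
    note * = involution_form.derived2_mat_lsa[OF form[OF k] N this]
    show "mat_ops ?N h" "lcar h = ?L2 k" "lev h = lcar h \<inter> mat_ev ?N (2 * k)" "lodd h = lcar h \<inter> mat_odd ?N (2 * k)"
      using * unfolding h oo_PiPi_def gram_eq_inv_mat[OF k] N by simp_all
  qed
  have pe: "mat_ops ?N h" "lcar h = ?L2 0" "lev h = lcar h \<inter> mat_ev ?N n" "lodd h = lcar h \<inter> mat_odd ?N n"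
    if h: "h = derived (derived (pe n))" for h :: "('a, 'a mat) lsa"
  proof -
    have N: "n + n = ?N" by simp
    have "{X \<in> carrier_mat ?N ?N. transpose_mat X * ?inv 0 + ?inv 0 * X = 0\<^sub>m ?N ?N} = form_lie ?N (?inv 0)"
      by (simp add: form_lie_def)
    note * = involution_form.derived2_mat_lsa[OF form[OF le0] N this]
    show "mat_ops ?N h" "lcar h = ?L2 0" "lev h = lcar h \<inter> mat_ev ?N n" "lodd h = lcar h \<inter> mat_odd ?N n"
      using * unfolding h pe_def Pi_mat_eq_inv_mat by simp_all
  qed
  have o2: "mat_ops ?N o2" "lcar o2 = ?L2 0"
  proof -
    have "o2 = derived (derived (oo_PiPi (2 * 0) (2 * n - 2 * 0)))"
      unfolding o2_def o_Pi_def by simp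
    then show "mat_ops ?N o2" "lcar o2 = ?L2 0" by (rule oo(1,2)[OF le0])+
  qed
  interpret B: involution_form ?N "TYPE('a)" "oo_inv n 0" by (rule form[OF le0])
  interpret H: mat_lie ?N "TYPE('a)" o2 by (rule B.mat_lie_L2[OF o2])
  from H.grading_derivation[OF grading[unfolded g_def]]
  obtain D where *: "is_derivation H.q D \<and> (\<forall>x\<in>g0. D x = lzero H.q) \<and> (\<forall>x\<in>g1. D x = x)
    \<and> (\<forall>x\<in>lcar H.q. D (D x) = D x)" ..
  then have D: "is_derivation H.q D" "\<And>x. x \<in> g0 \<Longrightarrow> D x = lzero H.q" "\<And>x. x \<in> g1 \<Longrightarrow> D x = x"
    "\<And>x. x \<in> lcar H.q \<Longrightarrow> D (D x) = D x"
    by (simp_all only: Ball_def)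
  obtain M where M0: "M \<in> o_Pi_tilde ?N" and "\<forall>X\<in>lcar o2. D (H.K X) = H.K (M * X - X * M)"
    using Der D(1) unfolding g_def by blast
  then have DM: "D (H.K X) = H.K (mcomm M X)" if "X \<in> lcar o2" for X
    using that by (simp add: mcomm_def)
  obtain c where M: "M \<in> carrier_mat ?N ?N" and adj: "transpose_mat M * B.G + B.G * M = c \<cdot>\<^sub>m B.G"
    using M0 unfolding o_Pi_tilde_def Pi_mat_eq_inv_mat by blast
  \<comment> \<open>\<open>M\<close> is only known to lie in the larger algebra
    \<open>o_Pi_tilde\<close>. That commutation with it preserves \<open>o2\<close> follows from
    \<open>D\<close> mapping the quotient to itself, and it is needed to apply \<open>DM\<close>
    twice below.\<close>
  have M_car: "mcomm M X \<in> lcar o2" if X: "X \<in> lcar o2" for X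
  proof -
    have "H.K (mcomm M X) \<in> lcar H.q"
      using D(1) X unfolding DM[OF X, symmetric] is_derivation_def by (simp add: H.q_car)
    then obtain W where W: "W \<in> lcar o2" "H.K (mcomm M X) = H.K W" unfolding H.q_car by blast
    then have "mcomm M X + W \<in> center o2" using M X by (simp add: H.K_eq_iff)
    then have "(mcomm M X + W) + W \<in> lcar o2" by (rule H.car_closed(1)[OF H.Z_car W(1)])
    moreover have "(mcomm M X + W) + W = mcomm M X" using M X W by (simp add: B.mat_ac)
    ultimately show ?thesis by (simp only:)
  qed
  have Mg0: "mcomm M X \<in> center o2" if X: "X \<in> lcar o2" "H.K X \<in> g0" for X
  proof -
    have "H.K (mcomm M X) = H.K (0\<^sub>m ?N ?N)" using DM[OF X(1)] D(2)[OF X(2)] by (simp add: H.q_zero)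
    then show ?thesis using M X by (simp add: H.K_eq_iff)
  qed
  have Mg1: "mcomm M X + X \<in> center o2" if X: "X \<in> lcar o2" "H.K X \<in> g1" for X
  proof -
    have "H.K (mcomm M X) = H.K X" using DM[OF X(1)] D(3)[OF X(2)] by simp
    then show ?thesis using M X by (simp add: H.K_eq_iff)
  qed
  have "M * M + M \<in> scalar_mats ?N"
  proof (rule B.mcomm_center_scalar)
    fix X assume "X \<in> B.L2"
    then have X: "X \<in> lcar o2" by (simp add: o2)
    have "H.K (mcomm M (mcomm M X)) = H.K (mcomm M X)"
      using D(4)[of "H.K X"] DM[OF X] DM[OF M_car[OF X]] X by (simp add: H.q_car)
    then have "mcomm M (mcomm M X) + mcomm M X \<in> center o2" using M X by (simp add: H.K_eq_iff)
    then show "mcomm (M * M + M) X \<in> B.Z2"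
      using M X B.center_L2[OF o2] by (simp add: B.mcomm_add B.mcomm_twice B.Z2_eq)
  qed (use M in simp)
  then obtain l where l: "M * M + M = l \<cdot>\<^sub>m 1\<^sub>m ?N" by (auto simp: scalar_mats_def)
  obtain s where s: "s * s + s = l"
    using quadratic_root by blast
  define M' where "M' = M + s \<cdot>\<^sub>m 1\<^sub>m ?N"
  have M': "M' \<in> carrier_mat ?N ?N" "M' * M' = M'" "transpose_mat M' * B.G + B.G * M' = c \<cdot>\<^sub>m B.G"
    unfolding M'_def using M B.square_shift[OF M l s] B.shift_multiplier[OF M adj] by simp_all
  \<comment> \<open>Neither the shift that makes \<open>M\<close> idempotent nor the later exchange
    of eigenvalues changes the induced derivation.\<close>
  have mM': "mcomm M' X = mcomm M X" "mcomm (M' + r \<cdot>\<^sub>m 1\<^sub>m ?N) X = mcomm M X" if X: "X \<in> lcar o2" for X r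
  proof -
    show "mcomm M' X = mcomm M X" unfolding M'_def by (rule B.mcomm_shift[OF M H.car_CM[OF X]])
    then show "mcomm (M' + r \<cdot>\<^sub>m 1\<^sub>m ?N) X = mcomm M X"
      using B.mcomm_shift[OF M'(1) H.car_CM[OF X]] by simp
  qed
  note iso = graded_quotient_iso[OF form[OF le0] _ o2 _ _ _ _ _ _ _ _ grading[unfolded g_def]]
  from B.adapted_basis[OF refl M'] show ?thesis
  proof (elim disjE exE conjE bexE)
    fix k r P assume k: "k \<le> n div 2" and P: "P \<in> carrier_mat ?N ?N" "transpose_mat P * B.G * P = ?inv k"
      "(M' + r \<cdot>\<^sub>m 1\<^sub>m ?N) * P = P * parity_mat ?N (2 * k)"
    define h :: "('a, 'a mat) lsa" where "h = derived (derived (oo_PiPi (2 * k) (2 * n - 2 * k)))"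
    have kn: "k \<le> n" using k by simp
    have "lsa_iso (S_g_one g g0 g1) (quot h (center h))"
      unfolding g_def by (rule iso[OF form[OF kn] oo[OF kn h_def] P(1,2) _ P(3)])
        (use M' mM' Mg0 Mg1 in simp_all)
    then show ?thesis using k by (auto simp: h_def Let_def)
  next
    fix P assume P: "P \<in> carrier_mat ?N ?N" "transpose_mat P * B.G * P = ?inv 0" "M' * P = P * parity_mat ?N n"
    define h :: "('a, 'a mat) lsa" where "h = derived (derived (pe n))"
    have "lsa_iso (S_g_one g g0 g1) (quot h (center h))"
      unfolding g_def by (rule iso[OF form[OF le0] pe[OF h_def] P(1,2) _ P(3)])
        (use M' mM' Mg0 Mg1 in simp_all)
    then show ?thesis by (simp add: h_def Let_def)
  qed
qed

end
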